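(* Consider an analysis-suitable $G^1$ two-patch parameterization $\boldsymbol{F}^{(L)},\boldsymbol{F}^{(R)}\in\mathcal{S}(\mathcal{T}^{p,r}_k,[0,1]^2)$ with $\beta=0$ or $z_\beta=0$, and let $\phi_{0,i}$ ($0\le i\le\tilde n-1$), $\phi_{1,j}$ ($0\le j\le\bar n-1$) be the functions defined in the context. For $S\in\{L,R\}$ let $\boldsymbol{B}^{(S)}_0=(\phi_{0,i}\circ\boldsymbol{F}^{(S)})_{i=0}^{\tilde n-1}$, $\boldsymbol{B}^{(S)}_1=(\phi_{1,j}\circ\boldsymbol{F}^{(S)})_{j=0}^{\bar n-1}$, $\boldsymbol{B}^*_0=(N^{p,r}_{0,j})_{j=0}^{n-1}$, $\boldsymbol{B}^*_1=(N^{p,r}_{1,j})_{j=0}^{n-1}$ (column vectors), where $n=p+1+k(p-r)$. Then $$\begin{pmatrix}\boldsymbol{B}^{(S)}_0\\ \boldsymbol{B}^{(S)}_1\end{pmatrix}=\begin{pmatrix}A_1&A_2^{(S)}\\0&A_3^{(S)}\end{pmatrix}\begin{pmatrix}\boldsymbol{B}^*_0\\ \boldsymbol{B}^*_1\end{pmatrix},$$ with $A_1,A_2^{(S)}\in\mathbb{R}^{\tilde n\times n}$ and $A_3^{(S)}\in\mathbb{R}^{\bar n\times n}$ given as follows. Let $H^{q,s}_i$ denote the blossom of the B-spline $N^{q,s}_i$. For a linear function $w(t)=w_0(1-t)+w_1t$, $t\in[0,1]$, $w_0,w_1\in\mathbb{R}$, let $\hat A(w)=(\hat a^{(w)}_{i,j})_{i,j}$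 be given by $$\hat a^{(w)}_{i,j}=\frac1p\sum_{l=j+1}^{j+p}\bigl((1-t^{p,r}_l)w_0+t^{p,r}_lw_1\bigr)H^{p-1,r}_i(t^{p,r}_{j+1},\dots,t^{p,r}_{l-1},t^{p,r}_{l+1},\dots,t^{p,r}_{j+p}).$$ (a) If $\beta=0$, then $A_1=A_2^{(S)}=I_n$. (b) If $\beta\neq0$ and $z_\beta=0$, then $A_1=\bar A$ and $A_2^{(S)}=\bar A+\frac{1}{(k+1)p}\tilde A\,\hat A(\beta^{(S)})$, where the entries of $\bar A=(\bar a_{i,j})_{i,j}$ and $\tilde A=(\tilde a_{i,j})_{i,j}$ are given by $$\bar a_{i,j}=H^{p,r+1}_i(t^{p,r}_{j+1},\dots,t^{p,r}_{j+p}),$$ $$\tilde a_{i,j}=\frac{p}{t^{p,r+1}_{j+p+1}-t^{p,r+1}_{j+1}}\Bigl(H^{p,r+1}_i(t^{p-1,r}_{j+1},\dots,t^{p-1,r}_{j+p-1},t^{p,r+1}_{j+p+1})-H^{p,r+1}_i(t^{p-1,r}_{j+1},\dots,t^{p-1,r}_{j+p-1},t^{p,r+1}_{j+1})\Bigr).$$ In both cases $A_3^{(S)}=\frac{1}{(k+1)p}\alpha^{(S)}I_n$ if $d_\alpha=0$ (where $\alpha^{(S)}$ is a constant), and $A_3^{(S)}=\frac{1}{(k+1)p}\hat A(\alpha^{(S)})$ if $d_\alpha=1$. Here $I_n$ is the $n\times n$ identity matrix.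
   Context: Splines. Let $p\ge 3$, $1\le r\le p-2$ and $k\ge 0$ be integers and $0<\tau_1<\dots<\tau_k<1$. For a degree $q$ and regularity $s$, $\mathcal{T}^{q,s}_k=(t^{q,s}_0,\dots,t^{q,s}_{2q+1+k(q-s)})$ is the nondecreasing open knot vector on $[0,1]$ in which $0$ and $1$ occur $q+1$ times and each inner knot $\tau_i$ occurs $q-s$ times. $\mathcal{S}(\mathcal{T}^{q,s}_k,[0,1])$ is the space of splines of degree $q$ with this knot vector, with B-spline basis $N^{q,s}_i$, $i=0,\dots,q+k(q-s)$; $\mathcal{S}(\mathcal{T}^{q,s}_k,[0,1]^2)$ is the tensor-product space with basis $N^{q,s}_{i,j}(u,v)=N^{q,s}_i(u)N^{q,s}_j(v)$. $\mathcal{P}^m([0,1])$ is the space of polynomials of degree at most $m$. Blossoms. The blossom of a spline function $h=\sum_{i}d_iN^{q,s}_i\in\mathcal{S}(\mathcal{T}^{q,s}_k,[0,1])$ is the function $H:\mathbb{R}^q\to\mathbb{R}$ that is symmetric, multi-affine and satisfies $H(t,\dots,t)=h(t)$. It satisfies $H(t^{q,s}_{i+1},\dots,t^{q,s}_{i+q})=d_i$ for $i=0,\dots,q+k(q-s)$, and its value $H(s_1,\dots,s_q)$ at arbitrary arguments is computed from these values by recursive use of the convex combinations $$H(t^{q,s}_{i+1},\dots,t^{q,s}_{i+q-m},s_1,\dots,s_m)=(1-\gamma^m_i(s_m))H(t^{q,s}_i,\dots,t^{q,s}_{i+q-m},s_1,\dots,s_{m-1})+\gamma^m_i(s_m)H(t^{q,s}_{i+1},\dots,t^{q,s}_{i+q-m+1},s_1,\dots,s_{m-1}),$$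 for $i=m,\dots,q+k(q-s)$, $m=1,\dots,q$, with $\gamma^m_i(x)=\frac{x-t^{q,s}_i}{t^{q,s}_{i+q-m+1}-t^{q,s}_i}$. Geometry. For $S\in\{L,R\}$, $\boldsymbol{F}^{(S)}:[0,1]^2\to\Omega^{(S)}\subset\mathbb{R}^2$ is a regular, bijective map with both components in $\mathcal{S}(\mathcal{T}^{p,r}_k,[0,1]^2)$; $\Omega=\Omega^{(L)}\cup\Omega^{(R)}$, and the two patches share a whole edge as common interface $\Omega^{(L)}\cap\Omega^{(R)}$, parameterized by $\boldsymbol{F}_0(v)=\boldsymbol{F}^{(L)}(0,v)=\boldsymbol{F}^{(R)}(0,v)$. The parameterization is analysis-suitable $G^1$ if there exist $\alpha^{(L)},\alpha^{(R)},\beta^{(L)},\beta^{(R)}\in\mathcal{P}^1([0,1])$, with $\alpha^{(L)},\alpha^{(R)}$ relatively prime and $\alpha^{(L)}\alpha^{(R)}<0$ on $[0,1]$, such that, with $\beta=\alpha^{(L)}\beta^{(R)}-\alpha^{(R)}\beta^{(L)}$, $\alpha^{(R)}(v)D_u\boldsymbol{F}^{(L)}(0,v)-\alpha^{(L)}(v)D_u\boldsymbol{F}^{(R)}(0,v)+\beta(v)\boldsymbol{F}_0'(v)=\boldsymbol{0}$ for all $v\in[0,1]$. $\alpha^{(L)},\alpha^{(R)},\beta$ are unique up to a common nonzero constant and are fixed; $\beta^{(L)},\beta^{(R)}\in\mathcal{P}^1([0,1])$ is the pair with $\beta=\alpha^{(L)}\beta^{(R)}-\alpha^{(R)}\beta^{(L)}$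 minimizing $\|\beta^{(L)}\|^2_{L_2([0,1])}+\|\beta^{(R)}\|^2_{L_2([0,1])}$ (so both are $0$ if $\beta=0$). $d_\alpha=\max(\deg\alpha^{(L)},\deg\alpha^{(R)})\in\{0,1\}$; $z_\beta$ is the number of inner knots $\tau_i$ with $\beta(\tau_i)=0$. Basis functions. Let $\tilde N_i$, $0\le i\le\tilde n-1$, be the B-splines of $\mathcal{S}(\mathcal{T}^{p,r}_k,[0,1])$ if $\beta=0$, and of $\mathcal{S}(\mathcal{T}^{p,r+1}_k,[0,1])$ if $\beta\ne0$ and $z_\beta=0$ ($\tilde n$ is the dimension of the respective space). Let $\bar N_j$, $0\le j\le\bar n-1$, be the B-splines of $\mathcal{S}(\mathcal{T}^{p-d_\alpha,r}_k,[0,1])$, $\bar n$ its dimension. The functions $\phi_{0,i},\phi_{1,j}:\Omega\to\mathbb{R}$ are defined, for $S\in\{L,R\}$, by $$(\phi_{0,i}\circ\boldsymbol{F}^{(S)})(u,v)=\tilde N_i(v)(N^{p,r}_0(u)+N^{p,r}_1(u))+\beta^{(S)}(v)\tilde N_i'(v)\tfrac{1}{(k+1)p}N^{p,r}_1(u),\qquad(\phi_{1,j}\circ\boldsymbol{F}^{(S)})(u,v)=\tfrac{1}{(k+1)p}\alpha^{(S)}(v)\bar N_j(v)N^{p,r}_1(u).$$ Index ranges. In $\hat A(w)$, $0\le i\le p-1+k(p-1-r)$ and $0\le j\le n-1$; in $\bar A$, $0\le i\le\tilde n-1$ and $0\le j\le n-1$; in $\tilde A$, $0\le i\le\tilde n-1$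 and $0\le j\le p-1+k(p-1-r)$. *)

theory Defs
  imports "HOL-Analysis.Analysis" "Jordan_Normal_Form.Matrix"
begin

subsection \<open>Splines\<close>

text \<open>The list \<open>\<tau>\<close> contains the inner knots, so that \<open>k = length \<tau>\<close>. Knots and B-splines
  are indexed from 0.\<close>

definition knots :: "nat \<Rightarrow> nat \<Rightarrow> real list \<Rightarrow> real list" where
  "knots q s \<tau> = replicate (q + 1) 0 @ concat (map (replicate (q - s)) \<tau>) @ replicate (q + 1) 1"

definition spline_dim :: "nat \<Rightarrow> nat \<Rightarrow> real list \<Rightarrow> nat" where
  "spline_dim q s \<tau> = q + 1 + length \<tau> * (q - s)"

text \<open>Cox--de Boor recursion; fractions with denominator 0 count as 0. The knot intervals are
  half-open, except that the last nonempty one is closed, so that the B-splines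
  are the usual ones on the whole closed interval.\<close>

fun cox_de_boor :: "real list \<Rightarrow> nat \<Rightarrow> nat \<Rightarrow> real \<Rightarrow> real" where
  "cox_de_boor T 0 i x =
     (if T ! i \<le> x \<and> x < T ! (i + 1) \<or> x = last T \<and> T ! i < x \<and> T ! (i + 1) = x then 1 else 0)"
| "cox_de_boor T (Suc q) i x =
     (x - T ! i) / (T ! (i + q + 1) - T ! i) * cox_de_boor T q i x
   + (T ! (i + q + 2) - x) / (T ! (i + q + 2) - T ! (i + 1)) * cox_de_boor T q (i + 1) x"

definition bspline :: "nat \<Rightarrow> nat \<Rightarrow> real list \<Rightarrow> nat \<Rightarrow> real \<Rightarrow> real" where
  "bspline q s \<tau> i = cox_de_boor (knots q s \<tau>) q i"

definition tensor_spline_space :: "nat \<Rightarrow> nat \<Rightarrow> real list \<Rightarrow> (real \<times> real \<Rightarrow> real) set" where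
  "tensor_spline_space q s \<tau> =
     {f. \<exists>d. \<forall>u\<in>{0..1}. \<forall>v\<in>{0..1}. f (u, v) =
        (\<Sum>i<spline_dim q s \<tau>. \<Sum>j<spline_dim q s \<tau>. d i j * (bspline q s \<tau> i u * bspline q s \<tau> j v))}"

text \<open>Derivative on \<open>[0,1]\<close>, one-sided at the two end points.\<close>

abbreviation D01 :: "(real \<Rightarrow> 'b::real_normed_vector) \<Rightarrow> real \<Rightarrow> 'b" where
  "D01 f t \<equiv> vector_derivative f (at t within {0..1})"

subsection \<open>Blossoms\<close>

text \<open>Functions of \<open>q\<close> real arguments are functions on lists of length \<open>q\<close>.\<close>

definition symmetric_fun :: "nat \<Rightarrow> (real list \<Rightarrow> real) \<Rightarrow> bool" where
  "symmetric_fun q H \<longleftrightarrow> (\<forall>xs ys. length xs = q \<and> mset ys = mset xs \<longrightarrow> H ys = H xs)"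

definition multi_affine :: "nat \<Rightarrow> (real list \<Rightarrow> real) \<Rightarrow> bool" where
  "multi_affine q H \<longleftrightarrow>
     (\<forall>xs i x y c. length xs = q \<and> i < q \<longrightarrow>
        H (xs[i := (1 - c) * x + c * y]) = (1 - c) * H (xs[i := x]) + c * H (xs[i := y]))"

definition is_blossom_on :: "nat \<Rightarrow> real set \<Rightarrow> (real \<Rightarrow> real) \<Rightarrow> (real list \<Rightarrow> real) \<Rightarrow> bool" where
  "is_blossom_on q I h H \<longleftrightarrow>
     symmetric_fun q H \<and> multi_affine q H \<and> (\<forall>t\<in>I. H (replicate q t) = h t)"

text \<open>The nonempty knot interval starting at the largest knot below or equal to \<open>x\<close>
  (the last nonempty one if \<open>x\<close> is the last knot).\<close>

definition knot_span :: "real list \<Rightarrow> real \<Rightarrow> real set" where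
  "knot_span T x =
     (let a = Max {t \<in> set T. t \<le> x \<and> t < last T}; b = Min {t \<in> set T. a < t} in {a..b})"

text \<open>A multi-affine function has a polynomial diagonal, so a spline has one blossom for each of its
  polynomial pieces; on lists of length \<open>q\<close> this blossom is unique. The blossom of the spline is
  evaluated with the piece on the knot interval that contains the smallest argument. It is symmetric,
  \<open>H(t,\<dots>,t) = h(t)\<close> holds for all \<open>t \<in> [0,1]\<close> (for continuous \<open>h\<close>), and at \<open>q\<close> consecutive knots it
  gives the B-spline coefficients. The choice of the interval does not influence the entries of the
  matrices below: if the smallest and the largest argument there differ, the pieces on all knot
  intervals between them give the same value, and if all arguments equal \<open>t\<close>, each piece at \<open>t\<close>
  gives \<open>h(t)\<close>.\<close>

definition blossom :: "nat \<Rightarrow> real list \<Rightarrow> (real \<Rightarrow> real) \<Rightarrow> real list \<Rightarrow> real" where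
  "blossom q T h xs = (SOME H. is_blossom_on q (knot_span T (Min (set xs))) h H) xs"

text \<open>\<open>bspline_blossom q s \<tau> i\<close> is the function \<open>H\<^sup>q\<^sup>,\<^sup>s\<^sub>i\<close>.\<close>

definition bspline_blossom :: "nat \<Rightarrow> nat \<Rightarrow> real list \<Rightarrow> nat \<Rightarrow> real list \<Rightarrow> real" where
  "bspline_blossom q s \<tau> i = blossom q (knots q s \<tau>) (bspline q s \<tau> i)"

subsection \<open>Two-patch geometry\<close>

datatype side = Left | Right

abbreviation unit_square :: "(real \<times> real) set" where
  "unit_square \<equiv> {0..1} \<times> {0..1}"

definition D_u :: "(real \<times> real \<Rightarrow> 'b::real_normed_vector) \<Rightarrow> real \<times> real \<Rightarrow> 'b" where
  "D_u f = (\<lambda>(u, v). D01 (\<lambda>x. f (x, v)) u)"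

definition D_v :: "(real \<times> real \<Rightarrow> 'b::real_normed_vector) \<Rightarrow> real \<times> real \<Rightarrow> 'b" where
  "D_v f = (\<lambda>(u, v). D01 (\<lambda>y. f (u, y)) v)"

definition regular :: "(real \<times> real \<Rightarrow> real \<times> real) \<Rightarrow> bool" where
  "regular f \<longleftrightarrow> (\<forall>x\<in>unit_square. fst (D_u f x) * snd (D_v f x) - snd (D_u f x) * fst (D_v f x) \<noteq> 0)"

definition two_patch_param ::
  "nat \<Rightarrow> nat \<Rightarrow> real list \<Rightarrow> (side \<Rightarrow> real \<times> real \<Rightarrow> real \<times> real) \<Rightarrow> (side \<Rightarrow> (real \<times> real) set) \<Rightarrow> bool" where
  "two_patch_param p r \<tau> F \<Omega> \<longleftrightarrow>
     (\<forall>S. fst \<circ> F S \<in> tensor_spline_space p r \<tau> \<and> snd \<circ> F S \<in> tensor_spline_space p r \<tau>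
        \<and> bij_betw (F S) unit_square (\<Omega> S) \<and> regular (F S))
     \<and> (\<forall>v\<in>{0..1}. F Left (0, v) = F Right (0, v))
     \<and> \<Omega> Left \<inter> \<Omega> Right = (\<lambda>v. F Left (0, v)) ` {0..1}"

definition beta_of :: "(side \<Rightarrow> real poly) \<Rightarrow> (side \<Rightarrow> real poly) \<Rightarrow> real poly" where
  "beta_of \<alpha> \<beta>' = \<alpha> Left * \<beta>' Right - \<alpha> Right * \<beta>' Left"

text \<open>\<open>\<alpha> S\<close> and \<open>\<beta>' S\<close> are the gluing functions of patch \<open>S\<close>; the parameterization is
  analysis-suitable \<open>G\<^sup>1\<close> if this holds for some \<open>\<alpha>\<close> and \<open>\<beta>'\<close>.\<close>

definition gluing_data ::
  "(side \<Rightarrow> real \<times> real \<Rightarrow> real \<times> real) \<Rightarrow> (side \<Rightarrow> real poly) \<Rightarrow> (side \<Rightarrow> real poly) \<Rightarrow> bool" where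
  "gluing_data F \<alpha> \<beta>' \<longleftrightarrow>
     (\<forall>S. degree (\<alpha> S) \<le> 1 \<and> degree (\<beta>' S) \<le> 1)
     \<and> coprime (\<alpha> Left) (\<alpha> Right)
     \<and> (\<forall>v\<in>{0..1}. poly (\<alpha> Left) v * poly (\<alpha> Right) v < 0)
     \<and> (\<forall>v\<in>{0..1}. poly (\<alpha> Right) v *\<^sub>R D_u (F Left) (0, v) - poly (\<alpha> Left) v *\<^sub>R D_u (F Right) (0, v)
          + poly (beta_of \<alpha> \<beta>') v *\<^sub>R D01 (\<lambda>t. F Left (0, t)) v = 0)"

definition sq_L2_norms :: "(side \<Rightarrow> real poly) \<Rightarrow> real" where
  "sq_L2_norms \<beta>' =
     integral {0..1} (\<lambda>v. (poly (\<beta>' Left) v)\<^sup>2) + integral {0..1} (\<lambda>v. (poly (\<beta>' Right) v)\<^sup>2)"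

definition minimal_beta :: "(side \<Rightarrow> real poly) \<Rightarrow> (side \<Rightarrow> real poly) \<Rightarrow> bool" where
  "minimal_beta \<alpha> \<beta>' \<longleftrightarrow>
     (\<forall>\<gamma>. (\<forall>S. degree (\<gamma> S) \<le> 1) \<and> beta_of \<alpha> \<gamma> = beta_of \<alpha> \<beta>' \<longrightarrow> sq_L2_norms \<beta>' \<le> sq_L2_norms \<gamma>)"

definition d_alpha :: "(side \<Rightarrow> real poly) \<Rightarrow> nat" where
  "d_alpha \<alpha> = max (degree (\<alpha> Left)) (degree (\<alpha> Right))"

definition z_beta :: "real list \<Rightarrow> real poly \<Rightarrow> nat" where
  "z_beta \<tau> b = card {i. i < length \<tau> \<and> poly b (\<tau> ! i) = 0}"

subsection \<open>Basis functions\<close>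

text \<open>The regularity of the splines used along the interface for the first family of functions.
  It is meant for \<open>b = 0\<close> and for \<open>z_beta \<tau> b = 0\<close> only.\<close>

definition tilde_reg :: "nat \<Rightarrow> real poly \<Rightarrow> nat" where
  "tilde_reg r b = (if b = 0 then r else r + 1)"

text \<open>The defining equations determine the two families on \<open>\<Omega> Left \<union> \<Omega> Right\<close>; the values
  elsewhere are irrelevant.\<close>

definition phi0 :: "nat \<Rightarrow> nat \<Rightarrow> real list \<Rightarrow> (side \<Rightarrow> real \<times> real \<Rightarrow> real \<times> real) \<Rightarrow>
    (side \<Rightarrow> real poly) \<Rightarrow> (side \<Rightarrow> real poly) \<Rightarrow> nat \<Rightarrow> real \<times> real \<Rightarrow> real" where
  "phi0 p r \<tau> F \<alpha> \<beta>' i = (SOME \<phi>. \<forall>S. \<forall>u\<in>{0..1}. \<forall>v\<in>{0..1}. \<phi> (F S (u, v)) =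
     (let g = bspline p (tilde_reg r (beta_of \<alpha> \<beta>')) \<tau> i in
        g v * (bspline p r \<tau> 0 u + bspline p r \<tau> 1 u)
        + poly (\<beta>' S) v * D01 g v * (1 / (real (length \<tau> + 1) * real p)) * bspline p r \<tau> 1 u))"

definition phi1 :: "nat \<Rightarrow> nat \<Rightarrow> real list \<Rightarrow> (side \<Rightarrow> real \<times> real \<Rightarrow> real \<times> real) \<Rightarrow>
    (side \<Rightarrow> real poly) \<Rightarrow> nat \<Rightarrow> real \<times> real \<Rightarrow> real" where
  "phi1 p r \<tau> F \<alpha> j = (SOME \<phi>. \<forall>S. \<forall>u\<in>{0..1}. \<forall>v\<in>{0..1}. \<phi> (F S (u, v)) =
     1 / (real (length \<tau> + 1) * real p) * poly (\<alpha> S) v * bspline (p - d_alpha \<alpha>) r \<tau> j v * bspline p r \<tau> 1 u)"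

subsection \<open>Coefficient matrices\<close>

definition A_hat :: "nat \<Rightarrow> nat \<Rightarrow> real list \<Rightarrow> real \<Rightarrow> real \<Rightarrow> real mat" where
  "A_hat p r \<tau> w0 w1 = (let t = (!) (knots p r \<tau>) in
     Matrix.mat (spline_dim (p - 1) r \<tau>) (spline_dim p r \<tau>) (\<lambda>(i, j).
       1 / real p * (\<Sum>l\<in>{j+1..j+p}. ((1 - t l) * w0 + t l * w1) *
         bspline_blossom (p - 1) r \<tau> i (map t ([j+1..<l] @ [l+1..<j+p+1])))))"

definition A_bar :: "nat \<Rightarrow> nat \<Rightarrow> real list \<Rightarrow> real mat" where
  "A_bar p r \<tau> = (let t = (!) (knots p r \<tau>) in
     Matrix.mat (spline_dim p (r + 1) \<tau>) (spline_dim p r \<tau>) (\<lambda>(i, j).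
       bspline_blossom p (r + 1) \<tau> i (map t [j+1..<j+p+1])))"

definition A_tilde :: "nat \<Rightarrow> nat \<Rightarrow> real list \<Rightarrow> real mat" where
  "A_tilde p r \<tau> = (let t = (!) (knots p (r + 1) \<tau>); t' = (!) (knots (p - 1) r \<tau>) in
     Matrix.mat (spline_dim p (r + 1) \<tau>) (spline_dim (p - 1) r \<tau>) (\<lambda>(i, j).
       real p / (t (j + p + 1) - t (j + 1)) *
         (bspline_blossom p (r + 1) \<tau> i (map t' [j+1..<j+p] @ [t (j + p + 1)])
          - bspline_blossom p (r + 1) \<tau> i (map t' [j+1..<j+p] @ [t (j + 1)]))))"

end

theory Submission
  imports Defs
begin

text \<open>Every symmetric multi-affine function \<open>H\<close> of \<open>q\<close> arguments is, on a knot interval, the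
  combination of the B-spline blossoms with coefficients \<open>H(t\<^sub>j\<^sub>+\<^sub>1,\<dots>,t\<^sub>j\<^sub>+\<^sub>q)\<close>, for any knot vector of
  degree \<open>q\<close> with these break points. Apply this to the blossoms of the polynomial pieces of a
  B-spline over a coarser knot vector, of its derivative, and of its product with a linear function.
  The coefficients do not depend on the piece: the blossoms of two neighbouring pieces agree as soon as
  the arguments contain all copies of the knot between them, and the consecutive knots of the target
  knot vector do.\<close>

subsection \<open>Symmetric multi-affine functions\<close>

text \<open>The matrix product in case (b) comes from how degrees and regularities fit:
  differentiation leads from degree \<open>p\<close>, regularity \<open>r + 1\<close> to degree
  \<open>p - 1\<close>, regularity \<open>r\<close>, and a linear factor leads on to degree
  \<open>p\<close> at the same regularity. The obstacle is that a matrix entry is a single number,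
  while the spline has one blossom per piece, so the entry has to be right on every piece where the
  target B-spline lives. The multiplicities just suffice: lowering the degree at fixed regularity
  saves one copy of each inner knot, which pays for the knot that \<open>A_hat\<close> deletes.
  Since \<open>blossom\<close> is defined by a choice, an explicit candidate is needed as well: the
  Cox-de Boor recursion with a separate argument at every level.\<close>

definition polar :: "nat \<Rightarrow> (real list \<Rightarrow> real) \<Rightarrow> bool" where
  "polar q H \<longleftrightarrow> symmetric_fun q H \<and> multi_affine q H"

lemma polar_perm: "polar q H \<Longrightarrow> mset ys = mset xs \<Longrightarrow> length xs = q \<Longrightarrow> H ys = H xs"
  unfolding polar_def symmetric_fun_def by blast

lemma polar_head:
  assumes "polar (Suc q) H" "length zs = q"
  shows "H (((1 - c) * x + c * y) # zs) = (1 - c) * H (x # zs) + c * H (y # zs)"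
proof -
  have "multi_affine (Suc q) H" using assms by (simp add: polar_def)
  from this[unfolded multi_affine_def, rule_format, of "0 # zs" 0 c x y] assms(2)
  show ?thesis by simp
qed

text \<open>Symmetry moves any argument to the front, so affinity in the head is enough; it can be
  read off from recursions on lists.\<close>

lemma polarI:
  assumes sym: "\<And>xs ys. length xs = q \<Longrightarrow> mset ys = mset xs \<Longrightarrow> H ys = H xs"
    and aff: "\<And>zs x y c. Suc (length zs) = q \<Longrightarrow>
      H (((1 - c) * x + c * y) # zs) = (1 - c) * H (x # zs) + c * H (y # zs)"
  shows "polar q H"
proof -
  have "H (xs[i := (1 - c) * x + c * y]) = (1 - c) * H (xs[i := x]) + c * H (xs[i := y])"
    if "length xs = q" "i < q" for xs i x y c
  proof -
    have *: "H (xs[i := z]) = H (z # take i xs @ drop (Suc i) xs)" for z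
      using that by (intro sym) (simp_all add: upd_conv_take_nth_drop)
    show ?thesis unfolding * using that by (intro aff) simp
  qed
  then show ?thesis
    unfolding polar_def symmetric_fun_def multi_affine_def using sym by blast
qed

lemma polar_Cons: "polar (Suc q) H \<Longrightarrow> polar q (\<lambda>xs. H (x # xs))"
proof (rule polarI)
  assume H: "polar (Suc q) H"
  show "H (x # ys) = H (x # xs)" if "length xs = q" "mset ys = mset xs" for xs ys
    using that by (intro polar_perm[OF H]) simp_all
  show "H (x # ((1 - c) * a + c * b) # zs) = (1 - c) * H (x # a # zs) + c * H (x # b # zs)"
    if "Suc (length zs) = q" for zs a b c
  proof -
    have *: "H (x # z # zs) = H (z # x # zs)" for z
      using that by (intro polar_perm[OF H]) simp_all
    show ?thesis unfolding * by (rule polar_head[OF H]) (use that in simp)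
  qed
qed

lemma polar_diff_scale:
  assumes "polar q G" "polar q H"
  shows "polar q (\<lambda>xs. a * (G xs - H xs))"
proof (rule polarI)
  fix xs ys :: "real list"
  assume "length xs = q" "mset ys = mset xs"
  then show "a * (G ys - H ys) = a * (G xs - H xs)"
    using polar_perm[OF assms(1)] polar_perm[OF assms(2)] by metis
next
  fix zs :: "real list" and x y c
  assume "Suc (length zs) = q"
  then show "a * (G (((1 - c) * x + c * y) # zs) - H (((1 - c) * x + c * y) # zs)) =
    (1 - c) * (a * (G (x # zs) - H (x # zs))) + c * (a * (G (y # zs) - H (y # zs)))"
    using assms by (auto simp: polar_head) (simp add: algebra_simps)
qed

text \<open>By affinity the partial derivative in one argument is the difference of the values at 1
  and 0, and by symmetry the \<open>m\<close> equal arguments contribute equally. For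
  \<open>m = 0\<close> the truncated \<open>m - 1\<close> is multiplied by 0.\<close>

lemma polar_deriv:
  assumes "polar (m + length ys) G"
  shows "((\<lambda>t. G (replicate m t @ ys)) has_real_derivative
    real m * (G (1 # replicate (m - 1) t @ ys) - G (0 # replicate (m - 1) t @ ys))) (at t)"
  using assms
proof (induction m arbitrary: ys)
  case 0
  then show ?case by simp
next
  case (Suc m)
  have head: "G (x # replicate m s @ ys) = (1 - x) * G (0 # replicate m s @ ys) + x * G (1 # replicate m s @ ys)"
    for x s using polar_head[of "m + length ys" G "replicate m s @ ys" x 0 1] Suc.prems by simp
  have move: "G (replicate m s @ x # ys) = G (x # replicate m s @ ys)" for x s
    using Suc.prems by (intro polar_perm[OF Suc.prems]) simp_all
  have eq: "(\<lambda>s. G (replicate (Suc m) s @ ys)) =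
      (\<lambda>s. (1 - s) * G (replicate m s @ 0 # ys) + s * G (replicate m s @ 1 # ys))"
    by (simp add: head[of s s for s] move)
  note IH0 = Suc.IH[of "0 # ys"] and IH1 = Suc.IH[of "1 # ys"]
  define D0 where "D0 = real m * (G (1 # replicate (m - 1) t @ 0 # ys) - G (0 # replicate (m - 1) t @ 0 # ys))"
  define D1 where "D1 = real m * (G (1 # replicate (m - 1) t @ 1 # ys) - G (0 # replicate (m - 1) t @ 1 # ys))"
  have "((\<lambda>s. (1 - s) * G (replicate m s @ 0 # ys) + s * G (replicate m s @ 1 # ys)) has_real_derivative
     (1 - t) * D0 + t * D1 + (G (replicate m t @ 1 # ys) - G (replicate m t @ 0 # ys))) (at t)"
    using IH0 IH1 Suc.prems
    by (auto intro!: derivative_eq_intros simp: D0_def D1_def algebra_simps)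
  moreover
  \<comment> \<open>\<open>D0\<close> and \<open>D1\<close> carry one copy of \<open>t\<close> less
    and a 0 or 1 in its place; interpolating between them restores the copy.\<close>
  have "(1 - t) * D0 + t * D1 = real m * (G (1 # replicate m t @ ys) - G (0 # replicate m t @ ys))"
  proof (cases m)
    case 0
    then show ?thesis by (simp add: D0_def D1_def)
  next
    case (Suc m')
    have *: "G (b # replicate m t @ ys) =
        (1 - t) * G (b # replicate m' t @ 0 # ys) + t * G (b # replicate m' t @ 1 # ys)" for b
    proof -
      have perm: "G (b # replicate m' t @ x # ys) = G (x # b # replicate m' t @ ys)" for x
        using Suc by (intro polar_perm[OF Suc.prems]) simp_all
      have "G (b # replicate m t @ ys) = G (t # b # replicate m' t @ ys)"
        using Suc by (intro polar_perm[OF Suc.prems]) simp_all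
      also have "\<dots> = (1 - t) * G (0 # b # replicate m' t @ ys) + t * G (1 # b # replicate m' t @ ys)"
        using polar_head[of "m + length ys" G "b # replicate m' t @ ys" t 0 1] Suc.prems Suc by simp
      finally show ?thesis by (simp add: perm)
    qed
    show ?thesis unfolding D0_def D1_def * using Suc by (simp add: algebra_simps)
  qed
  ultimately have "((\<lambda>s. (1 - s) * G (replicate m s @ 0 # ys) + s * G (replicate m s @ 1 # ys)) has_real_derivative
     real m * (G (1 # replicate m t @ ys) - G (0 # replicate m t @ ys)) + (G (replicate m t @ 1 # ys) - G (replicate m t @ 0 # ys))) (at t)"
    by (simp only:)
  moreover have "real m * (G (1 # replicate m t @ ys) - G (0 # replicate m t @ ys)) + (G (replicate m t @ 1 # ys) - G (replicate m t @ 0 # ys)) =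
      real (Suc m) * (G (1 # replicate (Suc m - 1) t @ ys) - G (0 # replicate (Suc m - 1) t @ ys))"
    by (simp add: move algebra_simps)
  ultimately show ?case
    unfolding eq by (simp only:)
qed

text \<open>Differentiating \<open>G(t,\<dots>,t,ys)\<close> shows that \<open>G(t,\<dots>,t,0,ys)\<close> and \<open>G(t,\<dots>,t,1,ys)\<close>
  agree where \<open>G(t,\<dots>,t,ys)\<close> vanishes; a convex combination of them is 0, so both are 0.\<close>

lemma polar_zero:
  assumes "polar (m + length ys) G" "\<And>t. a < t \<Longrightarrow> t < b \<Longrightarrow> G (replicate (m + length ys) t) = 0"
    and "a < t" "t < b"
  shows "G (replicate m t @ ys) = 0"
  using assms
proof (induction ys arbitrary: m t)
  case Nil
  then show ?case by simp
next
  case (Cons y ys)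
  have P: "polar (Suc m + length ys) G" using Cons.prems by simp
  have Z: "G (replicate (Suc m) t @ ys) = 0" if "a < t" "t < b" for t
    by (rule Cons.IH) (use Cons.prems that in simp_all)
  let ?D = "real (Suc m) * (G (1 # replicate m t @ ys) - G (0 # replicate m t @ ys))"
  have "((\<lambda>t. G (replicate (Suc m) t @ ys)) has_real_derivative ?D) (at t)"
    using polar_deriv[OF P, of t] by simp
  moreover have "((\<lambda>t. G (replicate (Suc m) t @ ys)) has_real_derivative 0) (at t)"
    by (rule has_field_derivative_transform_within_open[of "\<lambda>_. 0" _ _ "{a<..<b}"])
      (use Cons.prems Z in auto)
  ultimately have "?D = 0" by (rule DERIV_unique)
  then have eq: "G (1 # replicate m t @ ys) = G (0 # replicate m t @ ys)" by simp
  have head: "G (x # replicate m t @ ys) = G (0 # replicate m t @ ys)" for x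
    using polar_head[of "m + length ys" G "replicate m t @ ys" x 0 1] P eq by (simp add: algebra_simps)
  have "G (replicate m t @ y # ys) = G (y # replicate m t @ ys)"
    by (intro polar_perm[OF P]) simp_all
  also have "\<dots> = G (t # replicate m t @ ys)" using head by metis
  also have "\<dots> = 0" using Z Cons.prems by simp
  finally show ?case .
qed

text \<open>The difference vanishes on the diagonal over an open interval; \<open>polar_zero\<close>
  with no diagonal argument left covers arbitrary arguments.\<close>

lemma polar_unique:
  assumes "polar q G" "polar q H" "\<And>t. a < t \<Longrightarrow> t < b \<Longrightarrow> G (replicate q t) = H (replicate q t)"
    and "a < b" "length xs = q"
  shows "G xs = H xs"
proof -
  have "(\<lambda>xs. 1 * (G xs - H xs)) (replicate 0 ((a + b) / 2) @ xs) = 0"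
    by (rule polar_zero[where a = a and b = b]) (use assms polar_diff_scale[OF assms(1,2), of 1] in simp_all)
  then show ?thesis by simp
qed

subsection \<open>Multiplication by a linear function\<close>

definition delete_nth :: "nat \<Rightarrow> 'a list \<Rightarrow> 'a list" where
  "delete_nth l xs = take l xs @ drop (Suc l) xs"

lemma length_delete_nth [simp]: "l < length xs \<Longrightarrow> length (delete_nth l xs) = length xs - 1"
  by (simp add: delete_nth_def)

lemma mset_delete_nth: "l < length xs \<Longrightarrow> mset (delete_nth l xs) = mset xs - {#xs ! l#}"
proof -
  assume "l < length xs"
  then have "mset xs = mset (take l xs @ xs ! l # drop (Suc l) xs)" by (simp flip: id_take_nth_drop)
  then show ?thesis by (simp add: delete_nth_def)
qed

text \<open>The symmetrized product: the argument fed to \<open>w\<close> is averaged over all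
  positions. For affine \<open>w\<close> and the blossom \<open>H\<close> of \<open>h\<close> this
  is the blossom of the product of \<open>w\<close> and \<open>h\<close>; the entries of
  \<open>A_hat\<close> are its values at consecutive knots.\<close>

definition lin_mult :: "(real \<Rightarrow> real) \<Rightarrow> (real list \<Rightarrow> real) \<Rightarrow> real list \<Rightarrow> real" where
  "lin_mult w H xs = 1 / real (length xs) * (\<Sum>l<length xs. w (xs ! l) * H (delete_nth l xs))"

lemma polar_lin_mult:
  assumes H: "polar q H" and w: "\<And>x y c. w ((1 - c) * x + c * y) = (1 - c) * w x + c * w y"
  shows "polar (Suc q) (lin_mult w H)"
proof (rule polarI)
  \<comment> \<open>\<open>H\<close> factors through multisets, and a sum over the multiset of
    arguments visibly does not depend on their order.\<close>
  define h where "h M = H (SOME xs. mset xs = M)" for M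
  have Hh: "H xs = h (mset xs)" if "length xs = q" for xs
  proof -
    have "mset (SOME ys. mset ys = mset xs) = mset xs" by (rule someI[where x = xs]) simp
    with that show ?thesis unfolding h_def by (metis polar_perm[OF H])
  qed
  have *: "lin_mult w H xs = 1 / real (Suc q) * (\<Sum>x\<in>#mset xs. w x * h (mset xs - {#x#}))"
    if "length xs = Suc q" for xs
  proof -
    have "(\<Sum>l<length xs. w (xs ! l) * H (delete_nth l xs)) =
        (\<Sum>l<length xs. w (xs ! l) * h (mset xs - {#xs ! l#}))"
      using that by (intro sum.cong) (simp_all add: Hh mset_delete_nth)
    also have "\<dots> = sum_list (map (\<lambda>x. w x * h (mset xs - {#x#})) xs)"
      by (simp add: sum_list_sum_nth atLeast0LessThan)
    also have "\<dots> = (\<Sum>x\<in>#mset xs. w x * h (mset xs - {#x#}))"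
      by (simp flip: sum_mset_sum_list)
    finally show ?thesis using that by (simp add: lin_mult_def)
  qed
  show "lin_mult w H ys = lin_mult w H xs" if "length xs = Suc q" "mset ys = mset xs" for xs ys
    using *[of xs] *[of ys] mset_eq_length[OF that(2)] that by simp
next
  fix zs :: "real list" and x y c
  assume "Suc (length zs) = Suc q"
  then have len: "length zs = q" by simp
  \<comment> \<open>In each summand the head \<open>z\<close> goes either to \<open>w\<close> or to
    \<open>H\<close>, never to both, so every summand is affine in \<open>z\<close>.\<close>
  have expand: "lin_mult w H (z # zs) =
      1 / real (Suc q) * (w z * H zs + (\<Sum>l<q. w (zs ! l) * H (z # delete_nth l zs)))" for z
    unfolding lin_mult_def using len
    by (simp add: sum.lessThan_Suc_shift delete_nth_def del: sum.lessThan_Suc)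
  have aff: "H (((1 - c) * x + c * y) # delete_nth l zs) =
      (1 - c) * H (x # delete_nth l zs) + c * H (y # delete_nth l zs)" if "l < q" for l
    using polar_head[of "q - 1" H "delete_nth l zs" c x y] H that len by simp
  show "lin_mult w H (((1 - c) * x + c * y) # zs) =
    (1 - c) * lin_mult w H (x # zs) + c * lin_mult w H (y # zs)"
  proof -
    have "(\<Sum>l<q. w (zs ! l) * H (((1 - c) * x + c * y) # delete_nth l zs)) =
        (\<Sum>l<q. (1 - c) * (w (zs ! l) * H (x # delete_nth l zs)) + c * (w (zs ! l) * H (y # delete_nth l zs)))"
      by (intro sum.cong) (simp_all only: aff lessThan_iff, simp_all add: algebra_simps)
    also have "\<dots> = (1 - c) * (\<Sum>l<q. w (zs ! l) * H (x # delete_nth l zs)) +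
        c * (\<Sum>l<q. w (zs ! l) * H (y # delete_nth l zs))"
      by (simp add: sum.distrib sum_distrib_left)
    finally have sum: "(\<Sum>l<q. w (zs ! l) * H (((1 - c) * x + c * y) # delete_nth l zs)) = \<dots>" .
    show ?thesis
      unfolding expand w sum by (simp only: distrib_left distrib_right ac_simps)
  qed
qed

lemma lin_mult_diagonal: "lin_mult w H (replicate (Suc q) x) = w x * H (replicate q x)"
proof -
  have "delete_nth l (replicate (Suc q) x) = replicate q x" if "l < Suc q" for l
    using that by (simp add: delete_nth_def min_def del: replicate_Suc flip: replicate_add)
  then show ?thesis
    by (simp add: lin_mult_def del: replicate_Suc of_nat_Suc)
qed

subsection \<open>Blossoms of the pieces of a B-spline\<close>

text \<open>\<open>piece_blossom t \<mu> xs i\<close> is the blossom, at the arguments \<open>xs\<close>, of the polynomial that the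
  B-spline \<open>i\<close> of degree \<open>length xs\<close> equals on the knot interval from \<open>t \<mu>\<close> to \<open>t (\<mu> + 1)\<close>.\<close>

fun piece_blossom :: "(nat \<Rightarrow> real) \<Rightarrow> nat \<Rightarrow> real list \<Rightarrow> nat \<Rightarrow> real" where
  "piece_blossom t \<mu> [] i = (if i = \<mu> then 1 else 0)"
| "piece_blossom t \<mu> (x # xs) i =
     (x - t i) / (t (i + length xs + 1) - t i) * piece_blossom t \<mu> xs i
   + (t (i + length xs + 2) - x) / (t (i + length xs + 2) - t (i + 1)) * piece_blossom t \<mu> xs (i + 1)"

text \<open>The order is demanded only up to \<open>\<mu> + q + 1\<close>, the last knot of a
  B-spline of degree \<open>q\<close> living on the interval; beyond the end of a knot list nothing
  is known about the values.\<close>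

definition knot_interval :: "(nat \<Rightarrow> real) \<Rightarrow> nat \<Rightarrow> nat \<Rightarrow> bool" where
  "knot_interval t \<mu> q \<longleftrightarrow> t \<mu> < t (\<mu> + 1) \<and> (\<forall>i\<le>\<mu>. t i \<le> t \<mu>) \<and>
     (\<forall>i. \<mu> < i \<longrightarrow> i \<le> \<mu> + q + 1 \<longrightarrow> t (\<mu> + 1) \<le> t i)"

lemma knot_interval_mono: "knot_interval t \<mu> q \<Longrightarrow> q' \<le> q \<Longrightarrow> knot_interval t \<mu> q'"
  by (simp add: knot_interval_def)

lemma knot_interval_less:
  assumes "knot_interval t \<mu> q" "i \<le> \<mu>" "\<mu> < j" "j \<le> \<mu> + q + 1"
  shows "t i < t j"
proof -
  have "t i \<le> t \<mu>" "t \<mu> < t (\<mu> + 1)" "t (\<mu> + 1) \<le> t j"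
    using assms by (auto simp: knot_interval_def)
  then show ?thesis by linarith
qed

lemma piece_blossom_eq_0: "\<mu> < i \<or> i + length xs < \<mu> \<Longrightarrow> piece_blossom t \<mu> xs i = 0"
  by (induction xs arbitrary: i) auto

text \<open>Exchanging \<open>x\<close> and \<open>y\<close> changes the two summands by
  \<open>(y - x) / (c - b)\<close> with opposite signs.\<close>

lemma piece_blossom_swap_aux:
  fixes a b c d x y :: real
  assumes "a < c" "b < c" "b < d"
  shows "(y - a) / (c - a) * ((c - x) / (c - b)) + (d - y) / (d - b) * ((x - b) / (c - b)) =
    (x - a) / (c - a) * ((c - y) / (c - b)) + (d - x) / (d - b) * ((y - b) / (c - b))"
proof -
  have 1: "(y - a) * (c - x) - (x - a) * (c - y) = (y - x) * (c - a)" by (simp add: algebra_simps)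
  have 2: "(d - x) * (y - b) - (d - y) * (x - b) = (y - x) * (d - b)" by (simp add: algebra_simps)
  have "(y - a) / (c - a) * ((c - x) / (c - b)) - (x - a) / (c - a) * ((c - y) / (c - b)) = (y - x) / (c - b)"
    using assms by (simp add: 1 flip: diff_divide_distrib)
  moreover have "(d - x) / (d - b) * ((y - b) / (c - b)) - (d - y) / (d - b) * ((x - b) / (c - b)) = (y - x) / (c - b)"
    using assms by (simp add: 2 flip: diff_divide_distrib)
  ultimately show ?thesis by linarith
qed

lemma piece_blossom_swap:
  assumes "knot_interval t \<mu> (length zs + 2)"
  shows "piece_blossom t \<mu> (x # y # zs) i = piece_blossom t \<mu> (y # x # zs) i"
proof -
  define q where "q = length zs"
  let ?B = "piece_blossom t \<mu> zs"
  have expand: "piece_blossom t \<mu> (u # v # zs) i =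
      (u - t i) / (t (i + q + 2) - t i) * ((v - t i) / (t (i + q + 1) - t i)) * ?B i
    + ((u - t i) / (t (i + q + 2) - t i) * ((t (i + q + 2) - v) / (t (i + q + 2) - t (i + 1)))
     + (t (i + q + 3) - u) / (t (i + q + 3) - t (i + 1)) * ((v - t (i + 1)) / (t (i + q + 2) - t (i + 1)))) * ?B (i + 1)
    + (t (i + q + 3) - u) / (t (i + q + 3) - t (i + 1)) * ((t (i + q + 3) - v) / (t (i + q + 3) - t (i + 2))) * ?B (i + 2)"
    for u v by (simp add: q_def eval_nat_numeral distrib_left distrib_right mult.assoc
        del: times_divide_eq_left times_divide_eq_right)
  have mid: "((x - t i) / (t (i + q + 2) - t i) * ((t (i + q + 2) - y) / (t (i + q + 2) - t (i + 1)))
     + (t (i + q + 3) - x) / (t (i + q + 3) - t (i + 1)) * ((y - t (i + 1)) / (t (i + q + 2) - t (i + 1)))) * ?B (i + 1) =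
    ((y - t i) / (t (i + q + 2) - t i) * ((t (i + q + 2) - x) / (t (i + q + 2) - t (i + 1)))
     + (t (i + q + 3) - y) / (t (i + q + 3) - t (i + 1)) * ((x - t (i + 1)) / (t (i + q + 2) - t (i + 1)))) * ?B (i + 1)"
  \<comment> \<open>Of the three terms after two recursion levels the outer two are symmetric by
    inspection. In the middle one the denominators are positive if B-spline \<open>i + 1\<close>
    lives on the interval; otherwise its value is 0 and degenerate denominators do no harm.\<close>
  proof (cases "i + 1 \<le> \<mu> \<and> \<mu> \<le> i + 1 + q")
    case True
    have "t i < t (i + q + 2)" "t (i + 1) < t (i + q + 2)" "t (i + 1) < t (i + q + 3)"
      by (rule knot_interval_less[OF assms]; use True in \<open>simp add: q_def\<close>)+
    then show ?thesis by (simp only: piece_blossom_swap_aux)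
  next
    case False
    then have "?B (i + 1) = 0" by (intro piece_blossom_eq_0) (auto simp: q_def)
    then show ?thesis by simp
  qed
  show ?thesis unfolding expand mid by (simp add: mult_ac)
qed

lemma piece_blossom_perm:
  "knot_interval t \<mu> (length xs) \<Longrightarrow> mset ys = mset xs \<Longrightarrow> piece_blossom t \<mu> ys i = piece_blossom t \<mu> xs i"
proof (induction "length xs" arbitrary: xs ys i)
  case 0
  then show ?case by simp
next
  case (Suc n)
  obtain x xs' where xs: "xs = x # xs'" using Suc.hyps(2) by (cases xs) auto
  obtain y ys' where ys: "ys = y # ys'" using Suc.prems(2) xs by (cases ys) auto
  have KI: "knot_interval t \<mu> n" using knot_interval_mono[OF Suc.prems(1)] Suc.hyps(2) by simp
  have len: "length xs' = n" "length ys' = n"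
    using Suc.hyps(2) xs ys mset_eq_length[OF Suc.prems(2)] by simp_all
  have IH: "piece_blossom t \<mu> v j = piece_blossom t \<mu> u j" if "length u = n" "mset v = mset u" for u v j
  proof (rule Suc.hyps(1))
    show "n = length u" "knot_interval t \<mu> (length u)" "mset v = mset u"
      using that KI by auto
  qed
  show ?case
  proof (cases "x = y")
    case True
    then have "mset ys' = mset xs'" using Suc.prems(2) xs ys by simp
    then have "piece_blossom t \<mu> ys' j = piece_blossom t \<mu> xs' j" for j using IH len(1) by blast
    then show ?thesis using len by (simp add: xs ys True)
  next
    case False
    \<comment> \<open>The induction hypothesis permutes the tails, so both lists can be arranged to
      start with \<open>x\<close> and \<open>y\<close>; a single swap of these two remains.\<close>
    then have "y \<in># mset xs'"
      using arg_cong[OF Suc.prems(2), of set_mset] xs ys by auto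
    then obtain M where M: "mset xs' = add_mset y M" by (blast dest: multi_member_split)
    obtain zs where "mset zs = M" using ex_mset by blast
    with M have zs: "mset xs' = add_mset y (mset zs)" by simp
    have 1: "mset ys' = add_mset x (mset zs)"
      using Suc.prems(2) xs ys zs by (simp add: add_mset_commute)
    have lz: "length (x # zs) = n" "length (y # zs) = n"
      using arg_cong[OF zs, of size] len by simp_all
    have e1: "piece_blossom t \<mu> (x # xs') i = piece_blossom t \<mu> (x # y # zs) i"
      using IH[of "y # zs" xs'] zs lz len by simp
    have e2: "piece_blossom t \<mu> (y # ys') i = piece_blossom t \<mu> (y # x # zs) i"
      using IH[of "x # zs" ys'] 1 lz len by simp
    show ?thesis unfolding xs ys e1 e2
      by (rule piece_blossom_swap) (use Suc.prems(1) Suc.hyps(2) lz in simp)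
  qed
qed

lemma polar_piece_blossom: "knot_interval t \<mu> q \<Longrightarrow> polar q (\<lambda>xs. piece_blossom t \<mu> xs i)"
proof (rule polarI)
  assume "knot_interval t \<mu> q"
  then show "piece_blossom t \<mu> ys i = piece_blossom t \<mu> xs i" if "length xs = q" "mset ys = mset xs" for xs ys
    using that piece_blossom_perm by blast
  have "((1 - c) * x + c * y - A) / D * B = (1 - c) * ((x - A) / D * B) + c * ((y - A) / D * B)"
    and "(A - ((1 - c) * x + c * y)) / D * B = (1 - c) * ((A - x) / D * B) + c * ((A - y) / D * B)"
    for x y c A B D :: real
    by (simp_all add: add_divide_distrib diff_divide_distrib algebra_simps)
  then show "piece_blossom t \<mu> (((1 - c) * x + c * y) # zs) i =
    (1 - c) * piece_blossom t \<mu> (x # zs) i + c * piece_blossom t \<mu> (y # zs) i" for zs x y c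
    by (simp add: ring_distribs)
qed

text \<open>One step of the de Boor algorithm, read backwards, is the Cox--de Boor recursion for
  the arguments \<open>xs\<close>.\<close>

lemma polar_expansion:
  assumes "polar q H" "knot_interval t \<mu> q" "length xs = q" "q \<le> \<mu>"
  shows "H xs = (\<Sum>j\<le>\<mu>. H (map t [j + 1..<j + 1 + q]) * piece_blossom t \<mu> xs j)"
  using assms
proof (induction q arbitrary: H xs)
  case 0
  have "(\<Sum>j\<le>\<mu>. H [] * (if j = \<mu> then 1 else 0)) = H []"
    by (simp add: if_distrib cong: if_cong)
  then show ?case using 0 by simp
next
  case (Suc q)
  obtain x ys where xs: "xs = x # ys" using Suc.prems by (cases xs) auto
  have len: "length ys = q" using Suc.prems xs by simp
  let ?B = "piece_blossom t \<mu> ys"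
  let ?d = "\<lambda>j. H (map t [j + 1..<j + 1 + Suc q])"
  let ?u = "\<lambda>j. (x - t j) / (t (j + q + 1) - t j)"
  let ?v = "\<lambda>j. (t (j + q + 1) - x) / (t (j + q + 1) - t j)"
  \<comment> \<open>As \<open>Suc q \<le> \<mu>\<close>, the term at \<open>j = 0\<close> vanishes
    and the truncated \<open>j - 1\<close> is harmless. Both zeros are used in the index shift
    below.\<close>
  have B0: "?B 0 = 0" "?B (\<mu> + 1) = 0"
    using Suc.prems len by (auto intro!: piece_blossom_eq_0)
  \<comment> \<open>Writing \<open>x\<close> as an affine combination of \<open>t j\<close> and
    \<open>t (j + q + 1)\<close>, the neighbours of the knots in this value, turns it into a
    combination of the coefficients \<open>j - 1\<close> and \<open>j\<close>.\<close>
  have step: "H (x # map t [j + 1..<j + 1 + q]) * ?B j = ?d j * ?u j * ?B j + ?d (j - 1) * ?v j * ?B j"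
    if "j \<le> \<mu>" for j
  proof (cases "j = 0 \<or> j + q < \<mu>")
    case True
    then have "?B j = 0" using B0 len piece_blossom_eq_0 by auto
    then show ?thesis by simp
  next
    case False
    then have j: "0 < j" "j \<le> \<mu>" "\<mu> \<le> j + q" using that by auto
    have less: "t j < t (j + q + 1)"
      by (rule knot_interval_less[OF Suc.prems(2)]) (use j in auto)
    define c where "c = ?u j"
    have v: "?v j = 1 - c" using less by (simp add: c_def field_simps)
    have x: "(1 - c) * t j + c * t (j + q + 1) = x"
    proof -
      have "c * (t (j + q + 1) - t j) = x - t j" using less by (simp add: c_def)
      then show ?thesis by (simp add: algebra_simps)
    qed
    moreover have "H (x # map t [j + 1..<j + 1 + q]) =
        (1 - c) * H (t j # map t [j + 1..<j + 1 + q]) + c * H (t (j + q + 1) # map t [j + 1..<j + 1 + q])"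
      using polar_head[OF Suc.prems(1), of "map t [j + 1..<j + 1 + q]" c "t j" "t (j + q + 1)"]
      unfolding x by simp
    moreover have "t j # map t [j + 1..<j + 1 + q] = map t [j - 1 + 1..<j - 1 + 1 + Suc q]"
      using j by (simp add: upt_conv_Cons del: upt_Suc)
    moreover have "H (t (j + q + 1) # map t [j + 1..<j + 1 + q]) = ?d j"
      by (rule polar_perm[OF Suc.prems(1)]) simp_all
    ultimately have eq: "H (x # map t [j + 1..<j + 1 + q]) = (1 - c) * ?d (j - 1) + c * ?d j"
      by metis
    show ?thesis unfolding eq v c_def[symmetric] by (simp only: distrib_left distrib_right ac_simps)
  qed
  have "H xs = (\<Sum>j\<le>\<mu>. H (x # map t [j + 1..<j + 1 + q]) * ?B j)"
    unfolding xs using Suc.prems len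
    by (intro Suc.IH polar_Cons) (auto intro: knot_interval_mono)
  also have "\<dots> = (\<Sum>j\<le>\<mu>. ?d j * ?u j * ?B j + ?d (j - 1) * ?v j * ?B j)"
    by (intro sum.cong step) auto
  also have "\<dots> = (\<Sum>j\<le>\<mu>. ?d j * ?u j * ?B j) + (\<Sum>j\<le>Suc \<mu>. ?d (j - 1) * ?v j * ?B j)"
    using B0 by (simp add: sum.distrib)
  also have "(\<Sum>j\<le>Suc \<mu>. ?d (j - 1) * ?v j * ?B j) = (\<Sum>j\<le>\<mu>. ?d j * ?v (Suc j) * ?B (Suc j))"
    using B0 by (subst sum.atMost_Suc_shift) simp
  also have "(\<Sum>j\<le>\<mu>. ?d j * ?u j * ?B j) + \<dots> = (\<Sum>j\<le>\<mu>. ?d j * piece_blossom t \<mu> xs j)"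
    unfolding sum.distrib[symmetric] xs
    by (intro sum.cong) (simp_all add: len algebra_simps del: upt_Suc)
  finally show ?case .
qed

subsection \<open>Smoothness at the knots\<close>

text \<open>At a knot of multiplicity \<open>n\<close>, exactly one B-spline of degree
  \<open>n\<close> is nonzero. Seen from the piece left of the knot it is the last one living there,
  seen from the piece on the right the first one. The index is the same, since the piece index grows
  by \<open>n\<close>.\<close>

lemma piece_blossom_right_end:
  assumes "knot_interval t \<mu> n" "\<And>l. \<mu> < l \<Longrightarrow> l \<le> \<mu> + n \<Longrightarrow> t l = x"
  shows "piece_blossom t \<mu> (replicate n x) i = (if i = \<mu> then 1 else 0)"
  using assms
proof (induction n arbitrary: i)
  case 0
  then show ?case by simp
next
  case (Suc n)
  have IH: "piece_blossom t \<mu> (replicate n x) j = (if j = \<mu> then 1 else 0)" for j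
    by (rule Suc.IH) (use Suc.prems in \<open>auto intro: knot_interval_mono\<close>)
  have "t \<mu> < x"
    using Suc.prems(1) Suc.prems(2)[of "\<mu> + 1"] by (auto simp: knot_interval_def)
  moreover have "t (\<mu> + n + 1) = x" by (rule Suc.prems) auto
  moreover have "t (i + n + 2) = x" if "i + 1 = \<mu>"
  proof -
    have "i + n + 2 = \<mu> + n + 1" using that by simp
    then show ?thesis using \<open>t (\<mu> + n + 1) = x\<close> by metis
  qed
  ultimately show ?case by (auto simp: IH)
qed

lemma piece_blossom_left_end:
  assumes "knot_interval t \<mu> n" "\<And>l. \<mu> < l + n \<Longrightarrow> l \<le> \<mu> \<Longrightarrow> t l = x" "n \<le> \<mu>"
  shows "piece_blossom t \<mu> (replicate n x) i = (if i + n = \<mu> then 1 else 0)"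
  using assms
proof (induction n arbitrary: i)
  case 0
  then show ?case by simp
next
  case (Suc n)
  have IH: "piece_blossom t \<mu> (replicate n x) j = (if j + n = \<mu> then 1 else 0)" for j
    by (rule Suc.IH) (use Suc.prems in \<open>auto intro: knot_interval_mono\<close>)
  have "t i = x" if "i + n = \<mu>" by (rule Suc.prems) (use that in auto)
  moreover have "t (i + 1) = x" if "i + 1 + n = \<mu>" by (rule Suc.prems) (use that in auto)
  moreover have "t (i + 1) < t (i + n + 2)" if "i + 1 + n = \<mu>"
    by (rule knot_interval_less[OF Suc.prems(1)]) (use that in auto)
  ultimately show ?case by (auto simp: IH)
qed

lemma piece_blossom_append_cong:
  "(\<And>i. piece_blossom t \<mu> ys i = piece_blossom t \<nu> ys i) \<Longrightarrow>
    piece_blossom t \<mu> (xs @ ys) i = piece_blossom t \<nu> (xs @ ys) i"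
  by (induction xs arbitrary: i) auto

text \<open>The copies of \<open>x\<close> are moved to the end of the list, where the recursion
  starts. There both pieces yield the same unit vector, and the remaining levels do not mention the
  piece.\<close>

lemma piece_blossom_across_knot:
  assumes "knot_interval t \<mu> (length xs)" "knot_interval t (\<mu> + n) (length xs)"
    and "\<And>l. \<mu> < l \<Longrightarrow> l \<le> \<mu> + n \<Longrightarrow> t l = x" "n \<le> count (mset xs) x"
  shows "piece_blossom t \<mu> xs i = piece_blossom t (\<mu> + n) xs i"
proof -
  have "replicate_mset n x \<subseteq># mset xs" using assms(4) by (simp flip: count_le_replicate_mset_subset_eq)
  then obtain M where "mset xs = replicate_mset n x + M" by (metis subset_mset.le_iff_add)
  moreover obtain ys where "mset ys = M" using ex_mset by blast
  ultimately have *: "mset (ys @ replicate n x) = mset xs" by simp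
  have n: "n \<le> length xs" using assms(4) by (metis count_mset count_le_length le_trans)
  have "piece_blossom t \<mu> (ys @ replicate n x) i = piece_blossom t (\<mu> + n) (ys @ replicate n x) i"
  proof (rule piece_blossom_append_cong)
    fix i
    have "piece_blossom t \<mu> (replicate n x) i = (if i = \<mu> then 1 else 0)"
      using n assms by (intro piece_blossom_right_end) (auto intro: knot_interval_mono)
    moreover have "piece_blossom t (\<mu> + n) (replicate n x) i = (if i + n = \<mu> + n then 1 else 0)"
      using n assms by (intro piece_blossom_left_end) (auto intro: knot_interval_mono)
    ultimately show "piece_blossom t \<mu> (replicate n x) i = piece_blossom t (\<mu> + n) (replicate n x) i"
      by simp
  qed
  then show ?thesis using piece_blossom_perm[OF _ *] assms by metis
qed

subsection \<open>Open knot vectors\<close>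

text \<open>With equal arguments the two recursions coincide, so only degree 0 is compared, where
  sortedness excludes every interval but \<open>\<mu>\<close>. The second alternative for
  \<open>x\<close> is the closed right end of the last interval.\<close>

lemma cox_de_boor_eq_piece_blossom:
  assumes T: "sorted T" and \<mu>: "\<mu> + 1 < length T" "T ! \<mu> < T ! (\<mu> + 1)"
    and x: "T ! \<mu> \<le> x \<and> x < T ! (\<mu> + 1) \<or> x = last T \<and> T ! (\<mu> + 1) = x"
    and "i + q + 1 < length T"
  shows "cox_de_boor T q i x = piece_blossom ((!) T) \<mu> (replicate q x) i"
  using assms(5)
proof (induction q arbitrary: i)
  case 0
  have mono: "a \<le> b \<Longrightarrow> b < length T \<Longrightarrow> T ! a \<le> T ! b" for a b
    using T sorted_nth_mono by blast
  have last: "T ! a \<le> last T" if "a < length T" for a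
    using mono[of a "length T - 1"] that last_conv_nth[of T] by fastforce
  consider "i < \<mu>" | "i = \<mu>" | "\<mu> < i" by linarith
  then show ?case
  proof cases
    case 1
    then have "T ! (i + 1) \<le> T ! \<mu>" using mono \<mu> by simp
    then show ?thesis using 1 x \<mu> last[OF \<mu>(1)] by auto
  next
    case 2
    then show ?thesis using x \<mu> by auto
  next
    case 3
    then have "T ! (\<mu> + 1) \<le> T ! i" using mono 0 by simp
    then show ?thesis using 3 x last[of "i + 1"] 0 by auto
  qed
next
  case (Suc q)
  have "cox_de_boor T q i x = piece_blossom ((!) T) \<mu> (replicate q x) i"
    "cox_de_boor T q (i + 1) x = piece_blossom ((!) T) \<mu> (replicate q x) (i + 1)"
    by (rule Suc.IH; use Suc.prems in simp)+
  then show ?case by simp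
qed

section \<open>Positions of the break points in a knot vector\<close>

lemma nth_concat_replicate:
  "0 < c \<Longrightarrow> a < c * length ts \<Longrightarrow> concat (map (replicate c) ts) ! a = ts ! (a div c)"
proof (induction ts arbitrary: a)
  case Nil
  then show ?case by simp
next
  case (Cons t ts)
  show ?case
  proof (cases "a < c")
    case True
    then show ?thesis by (simp add: nth_append)
  next
    case False
    then have "concat (map (replicate c) ts) ! (a - c) = ts ! ((a - c) div c)"
      using Cons by (intro Cons.IH) auto
    moreover have "a div c = Suc ((a - c) div c)" using False Cons.prems by (simp add: le_div_geq)
    ultimately show ?thesis using False by (simp add: nth_append)
  qed
qed

lemma length_concat_replicate: "length (concat (map (replicate c) ts)) = c * length ts"
  by (induction ts) auto

lemma length_knots: "length (knots q s \<tau>) = spline_dim q s \<tau> + q + 1"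
  by (simp add: knots_def spline_dim_def length_concat_replicate)

text \<open>The position of the last copy of break point \<open>m\<close>, for \<open>m\<close> at
  most the number of inner knots; there the nonempty knot interval of piece \<open>m\<close>
  starts.\<close>

definition break_index :: "nat \<Rightarrow> nat \<Rightarrow> nat \<Rightarrow> nat" where
  "break_index q s m = q + m * (q - s)"

lemma break_index_Suc: "break_index q s (Suc m) = break_index q s m + (q - s)"
  by (simp add: break_index_def)

lemma break_index_mono: "m \<le> m' \<Longrightarrow> break_index q s m \<le> break_index q s m'"
  by (simp add: break_index_def)

lemma break_index_ge: "q \<le> break_index q s m"
  by (simp add: break_index_def)

locale inner_knots =
  fixes \<tau> :: "real list"
  assumes increasing: "sorted_wrt (<) \<tau>" and inner: "set \<tau> \<subseteq> {0<..<1}"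
begin

abbreviation k :: nat where "k \<equiv> length \<tau>"

text \<open>Break points do not depend on degree and regularity, so one piece number serves all knot
  vectors; \<open>break_index\<close> translates it.\<close>

definition break :: "nat \<Rightarrow> real" where
  "break m = (0 # \<tau> @ [1]) ! m"

lemma break_0 [simp]: "break 0 = 0"
  by (simp add: break_def)

lemma break_last [simp]: "break (Suc k) = 1"
  by (simp add: break_def)

lemma break_Suc: "m < k \<Longrightarrow> break (Suc m) = \<tau> ! m"
  by (simp add: break_def nth_append)

lemma break_less: "m < m' \<Longrightarrow> m' \<le> Suc k \<Longrightarrow> break m < break m'"
proof -
  have "sorted_wrt (<) (0 # \<tau> @ [1])"
    using increasing inner by (fastforce simp: sorted_wrt_append)
  then show "m < m' \<Longrightarrow> m' \<le> Suc k \<Longrightarrow> break m < break m'"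
    unfolding break_def by (rule sorted_wrt_nth_less) simp_all
qed

lemma break_le: "m \<le> m' \<Longrightarrow> m' \<le> Suc k \<Longrightarrow> break m \<le> break m'"
  using break_less[of m m'] by (cases "m = m'") auto

lemma break_le_iff: "m \<le> Suc k \<Longrightarrow> m' \<le> Suc k \<Longrightarrow> break m \<le> break m' \<longleftrightarrow> m \<le> m'"
  using break_less[of m' m] break_le[of m m'] by (meson leD not_le_imp_less)

lemma ex_piece:
  assumes "x \<in> {0..1}"
  obtains m where "m \<le> k" "break m \<le> x" "x \<le> break (Suc m)"
proof -
  have "\<exists>m\<le>n. break m \<le> x \<and> x \<le> break (Suc m)" if "x \<le> break (Suc n)" for n
    using that
  proof (induction n)
    case 0
    then show ?case using assms by auto
  next
    case (Suc n)
    then show ?case by (metis le_cases le_SucI)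
  qed
  from this[of k] show ?thesis using assms that by auto
qed

context
  fixes q s :: nat
  assumes sq: "s < q"
begin

abbreviation T :: "real list" where "T \<equiv> knots q s \<tau>"

lemma spline_dim_eq: "spline_dim q s \<tau> = Suc (break_index q s k)"
  by (simp add: spline_dim_def break_index_def)

lemma nth_knots_first: "l \<le> q \<Longrightarrow> T ! l = 0"
  unfolding knots_def by (subst nth_append) (auto simp del: replicate_Suc)

lemma nth_knots_inner:
  assumes "m < k" "break_index q s m < l" "l \<le> break_index q s (Suc m)"
  shows "T ! l = \<tau> ! m"
proof -
  define a where "a = l - (q + 1)"
  let ?c = "q - s"
  have a: "m * ?c \<le> a" "a < m * ?c + ?c" "l = q + 1 + a"
    using assms sq by (auto simp: a_def break_index_def)
  have "Suc m * ?c \<le> k * ?c" using assms(1) by (intro mult_le_mono1) simp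
  then have "a < ?c * k" using a by (simp add: mult.commute)
  moreover have "a div ?c = m" using a sq by (intro div_nat_eqI) (simp_all add: mult.commute)
  ultimately have "concat (map (replicate ?c) \<tau>) ! a = \<tau> ! m"
    using nth_concat_replicate[of ?c a \<tau>] sq by simp
  then show ?thesis
    unfolding knots_def a(3) using \<open>a < ?c * k\<close>
    by (simp add: nth_append length_concat_replicate del: replicate_Suc)
qed

lemma nth_knots_last:
  assumes "break_index q s k < l" "l < length T"
  shows "T ! l = 1"
proof -
  have "l - (q + 1) - k * (q - s) < q + 1"
    using assms unfolding length_knots by (simp add: break_index_def spline_dim_def)
  then show ?thesis
    using assms unfolding knots_def
    by (simp add: nth_append length_concat_replicate break_index_def mult.commute del: replicate_Suc)
qed

text \<open>The upper bound on \<open>l\<close> is restricted to \<open>m < k\<close> because the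
  last block has \<open>q + 1\<close> copies, an inner one only \<open>q - s\<close>.\<close>

lemma nth_knots_block:
  assumes "m \<le> k" "break_index q s m < l" "l < length T" "m < k \<Longrightarrow> l \<le> break_index q s (Suc m)"
  shows "T ! l = break (Suc m)"
proof (cases "m = k")
  case True
  then show ?thesis using nth_knots_last assms by simp
next
  case False
  then show ?thesis using nth_knots_inner[of m l] break_Suc assms by simp
qed

lemma nth_knots_break: "m \<le> k \<Longrightarrow> T ! break_index q s m = break m"
proof (cases m)
  case 0
  then show ?thesis using nth_knots_first by (simp add: break_index_def)
next
  case (Suc m')
  assume "m \<le> k"
  then show ?thesis
    using nth_knots_inner[of m' "break_index q s m"] break_Suc[of m'] Suc sq
    by (simp add: break_index_Suc)
qed

lemma sorted_knots: "sorted T"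
proof -
  have "sorted (concat (map (replicate c) ts))" if "sorted ts" for c and ts :: "real list"
    using that by (induction ts) (auto simp: sorted_append)
  moreover have "sorted \<tau>" using increasing by (simp add: strict_sorted_imp_sorted)
  ultimately have "sorted (concat (map (replicate (q - s)) \<tau>))" by blast
  moreover have "set (concat (map (replicate (q - s)) \<tau>)) \<subseteq> {0<..<1}" using inner by auto
  ultimately show ?thesis
    unfolding knots_def by (auto simp: sorted_append)
qed

lemma knots_mono: "l \<le> l' \<Longrightarrow> l' < length T \<Longrightarrow> T ! l \<le> T ! l'"
  using sorted_knots sorted_nth_mono by blast

lemma break_index_less_length: "m \<le> k \<Longrightarrow> break_index q s m + q + 1 < length T"
  using break_index_mono[of m k q s] by (simp add: length_knots spline_dim_eq)

lemma nth_knots_Suc_break: "m \<le> k \<Longrightarrow> T ! (break_index q s m + 1) = break (Suc m)"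
  using break_index_less_length[of m] sq by (intro nth_knots_block) (auto simp: break_index_Suc)

lemma knot_interval_knots: "m \<le> k \<Longrightarrow> knot_interval ((!) T) (break_index q s m) q"
  unfolding knot_interval_def nth_knots_Suc_break nth_knots_break
  using break_less[of m "Suc m"] break_index_less_length[of m]
  by (auto simp flip: nth_knots_break nth_knots_Suc_break intro!: knots_mono)

lemma last_knots: "last T = 1"
  by (simp add: knots_def)

lemma set_knots: "set T = break ` {..Suc k}"
proof -
  have "set T = set (0 # \<tau> @ [1])" using sq by (auto simp: knots_def)
  also have "\<dots> = (!) (0 # \<tau> @ [1]) ` {0..<length (0 # \<tau> @ [1])}"
    by (metis list.set_map map_nth set_upt)
  also have "\<dots> = break ` {..Suc k}"
    by (intro image_cong) (auto simp: break_def)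
  finally show ?thesis .
qed

lemma piece_blossom_knots_cong:
  assumes "m \<le> m'" "m' \<le> k" "length xs = q"
    and "\<And>e. m \<le> e \<Longrightarrow> e < m' \<Longrightarrow> q - s \<le> count (mset xs) (break (Suc e))"
  shows "piece_blossom ((!) T) (break_index q s m) xs i = piece_blossom ((!) T) (break_index q s m') xs i"
  using assms
proof (induction m' rule: dec_induct)
  case base
  then show ?case by simp
next
  case (step e)
  have "piece_blossom ((!) T) (break_index q s m) xs i = piece_blossom ((!) T) (break_index q s e) xs i"
    using step by simp
  also have "\<dots> = piece_blossom ((!) T) (break_index q s e + (q - s)) xs i"
  proof (rule piece_blossom_across_knot)
    show "knot_interval ((!) T) (break_index q s e) (length xs)"
      "knot_interval ((!) T) (break_index q s e + (q - s)) (length xs)"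
      using knot_interval_knots[of e] knot_interval_knots[of "Suc e"] step by (simp_all add: break_index_Suc)
    show "T ! l = break (Suc e)" if "break_index q s e < l" "l \<le> break_index q s e + (q - s)" for l
      using that step break_index_less_length[of "Suc e"]
      by (intro nth_knots_block) (auto simp: break_index_Suc)
    show "q - s \<le> count (mset xs) (break (Suc e))" using step by simp
  qed
  finally show ?case by (simp add: break_index_Suc)
qed

text \<open>The piece is closed although knot intervals are half-open: at an inner right end the
  next piece gives the value, and \<open>q\<close> equal arguments contain the \<open>q - s\<close>
  copies needed to change pieces.\<close>

lemma bspline_eq_piece_blossom:
  assumes "m \<le> k" "break m \<le> x" "x \<le> break (Suc m)" "i < spline_dim q s \<tau>"
  shows "bspline q s \<tau> i x = piece_blossom ((!) T) (break_index q s m) (replicate q x) i"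
proof -
  have half_open: "bspline q s \<tau> i x = piece_blossom ((!) T) (break_index q s m) (replicate q x) i"
    if "m \<le> k" "break m \<le> x" "x < break (Suc m) \<or> m = k \<and> x = 1" for m
    unfolding bspline_def
  proof (rule cox_de_boor_eq_piece_blossom[OF sorted_knots])
    show "break_index q s m + 1 < length T" using break_index_less_length[OF that(1)] by simp
    show "T ! break_index q s m < T ! (break_index q s m + 1)"
      using that by (simp add: nth_knots_break nth_knots_Suc_break[simplified] break_less)
    show "T ! break_index q s m \<le> x \<and> x < T ! (break_index q s m + 1) \<or>
        x = last T \<and> T ! (break_index q s m + 1) = x"
      using that by (auto simp: nth_knots_break nth_knots_Suc_break[simplified] last_knots)
    show "i + q + 1 < length T" using assms(4) by (simp add: length_knots)
  qed
  show ?thesis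
  proof (cases "x < break (Suc m) \<or> m = k")
    case True
    then show ?thesis using half_open[of m] assms by (auto simp: order_le_less)
  next
    case False
    then have m: "m < k" "x = break (Suc m)" using assms by auto
    have "bspline q s \<tau> i x = piece_blossom ((!) T) (break_index q s (Suc m)) (replicate q x) i"
      using m by (intro half_open) (auto intro: break_less)
    also have "\<dots> = piece_blossom ((!) T) (break_index q s m) (replicate q x) i"
      using m by (intro piece_blossom_knots_cong[symmetric]) (auto simp: le_less_Suc_eq)
    finally show ?thesis .
  qed
qed

text \<open>No piece starts at the last break point, hence \<open>min m k\<close>.\<close>

lemma knot_span_knots:
  assumes "m \<le> Suc k"
  shows "knot_span T (break m) = {break (min m k)..break (Suc (min m k))}"
proof -
  have "{t \<in> set T. t \<le> break m \<and> t < last T} = break ` {..min m k}" (is "?A = _")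
  proof -
    have iff: "break l \<le> break m \<and> break l < last T \<longleftrightarrow> l \<le> min m k" if "l \<le> Suc k" for l
      using break_le_iff[of l m] break_le_iff[of "Suc k" l] that assms
      by (auto simp: last_knots not_le[symmetric])
    have "l \<in> {l. l \<le> Suc k \<and> break l \<le> break m \<and> break l < last T} \<longleftrightarrow> l \<in> {..min m k}" for l
      using iff[of l] by auto
    then have "{l. l \<le> Suc k \<and> break l \<le> break m \<and> break l < last T} = {..min m k}" by blast
    moreover have "?A = break ` {l. l \<le> Suc k \<and> break l \<le> break m \<and> break l < last T}"
      unfolding set_knots by blast
    ultimately show ?thesis by simp
  qed
  then have a: "Max ?A = break (min m k)"
    using break_le assms by (auto intro!: Max_eqI)
  have "{t \<in> set T. break (min m k) < t} = break ` {Suc (min m k)..Suc k}" (is "?B = _")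
    unfolding set_knots by (auto simp: break_le_iff simp flip: not_le)
  then have "Min ?B = break (Suc (min m k))"
    using break_le by (auto intro!: Min_eqI)
  then show ?thesis using a by (simp add: knot_span_def)
qed

text \<open>The piece blossom shows that the choice has a candidate, and uniqueness on the nonempty
  knot span identifies the chosen function with it.\<close>

lemma bspline_blossom_eq_piece_blossom:
  assumes "i < spline_dim q s \<tau>" "length xs = q" "Min (set xs) = break m" "m \<le> Suc k"
  shows "bspline_blossom q s \<tau> i xs = piece_blossom ((!) T) (break_index q s (min m k)) xs i"
proof -
  let ?m = "min m k"
  let ?I = "{break ?m..break (Suc ?m)}"
  let ?B = "\<lambda>xs. piece_blossom ((!) T) (break_index q s ?m) xs i"
  let ?H = "SOME H. is_blossom_on q ?I (bspline q s \<tau> i) H"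
  have B: "polar q ?B" by (rule polar_piece_blossom) (rule knot_interval_knots, simp)
  have "is_blossom_on q ?I (bspline q s \<tau> i) ?B"
    using B bspline_eq_piece_blossom[of ?m] assms(1)
    by (auto simp: is_blossom_on_def polar_def)
  then have H: "is_blossom_on q ?I (bspline q s \<tau> i) ?H" by (rule someI[where P = "is_blossom_on q ?I (bspline q s \<tau> i)"])
  have "?H xs = ?B xs"
  proof (rule polar_unique[OF _ B])
    show "polar q ?H" using H by (simp add: is_blossom_on_def polar_def)
    show "?H (replicate q t) = ?B (replicate q t)" if "break ?m < t" "t < break (Suc ?m)" for t
      using H that bspline_eq_piece_blossom[of ?m t] assms(1) by (simp add: is_blossom_on_def)
    show "break ?m < break (Suc ?m)" by (rule break_less) auto
  qed (use assms in simp)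
  then show ?thesis
    unfolding bspline_blossom_def blossom_def assms(3) knot_span_knots[OF assms(4)] .
qed

end

end

context inner_knots
begin

subsection \<open>Spline coefficients as blossom values\<close>

text \<open>Coefficients are compared only for the B-splines living on piece \<open>m\<close>, so
  \<open>G\<close> may change with the piece while one sequence \<open>a\<close> serves all of
  them.\<close>

lemma spline_expansion:
  assumes "s < q" "polar q G" "m \<le> k" "break m \<le> x" "x \<le> break (Suc m)"
    and coeff: "\<And>j. j \<le> break_index q s m \<Longrightarrow> break_index q s m \<le> j + q \<Longrightarrow>
      a j = G (map ((!) (knots q s \<tau>)) [j + 1..<j + 1 + q])"
  shows "G (replicate q x) = (\<Sum>j<spline_dim q s \<tau>. a j * bspline q s \<tau> j x)"
proof -
  let ?\<mu> = "break_index q s m"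
  let ?B = "piece_blossom ((!) (knots q s \<tau>)) ?\<mu> (replicate q x)"
  have "G (replicate q x) = (\<Sum>j\<le>?\<mu>. G (map ((!) (knots q s \<tau>)) [j + 1..<j + 1 + q]) * ?B j)"
    using knot_interval_knots[OF assms(1,3)] assms(2) break_index_ge
    by (intro polar_expansion) auto
  also have "\<dots> = (\<Sum>j\<le>?\<mu>. a j * ?B j)"
  proof (rule sum.cong)
    fix j
    assume "j \<in> {..?\<mu>}"
    then show "G (map ((!) (knots q s \<tau>)) [j + 1..<j + 1 + q]) * ?B j = a j * ?B j"
      using coeff[of j] piece_blossom_eq_0[of ?\<mu> j "replicate q x"] by (cases "?\<mu> \<le> j + q") auto
  qed simp
  also have "\<dots> = (\<Sum>j<spline_dim q s \<tau>. a j * ?B j)"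
  proof (rule sum.mono_neutral_left)
    show "{..?\<mu>} \<subseteq> {..<spline_dim q s \<tau>}"
      using break_index_mono[OF assms(3), of q s] by (auto simp: spline_dim_eq[OF assms(1)])
    show "\<forall>j\<in>{..<spline_dim q s \<tau>} - {..?\<mu>}. a j * ?B j = 0"
      using piece_blossom_eq_0 by auto
  qed simp
  also have "\<dots> = (\<Sum>j<spline_dim q s \<tau>. a j * bspline q s \<tau> j x)"
    using bspline_eq_piece_blossom[OF assms(1,3-5)] by (intro sum.cong) auto
  finally show ?thesis .
qed

text \<open>The copies of break point \<open>e + 1\<close> are the knots after
  \<open>break_index p r e\<close> up to \<open>break_index p r (Suc e)\<close>; the two bounds
  place all of them among the \<open>p\<close> consecutive knots.\<close>

lemma count_knot_block:
  assumes "r < p" "e < k" "j \<le> break_index p r e" "break_index p r (Suc e) \<le> j + p"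
  shows "p - r \<le> count (mset (map ((!) (knots p r \<tau>)) [j + 1..<j + 1 + p])) (break (Suc e))"
proof -
  let ?a = "break_index p r e" and ?t = "(!) (knots p r \<tau>)"
  have b: "break_index p r (Suc e) = ?a + (p - r)" by (simp add: break_index_Suc)
  have "[j + 1..<j + 1 + p] = [j + 1..<?a + 1] @ [?a + 1..<j + 1 + p]"
    using upt_add_eq_append[of "j + 1" "?a + 1" "j + p - ?a"] assms b by (simp del: upt_Suc)
  also have "[?a + 1..<j + 1 + p] = [?a + 1..<?a + 1 + (p - r)] @ [?a + 1 + (p - r)..<j + 1 + p]"
    using upt_add_eq_append[of "?a + 1" "?a + 1 + (p - r)" "j + p - (?a + (p - r))"] assms b
    by (simp add: add.commute del: upt_Suc)
  finally have split: "[j + 1..<j + 1 + p] =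
    [j + 1..<?a + 1] @ [?a + 1..<?a + 1 + (p - r)] @ [?a + 1 + (p - r)..<j + 1 + p]" .
  have "map ?t [?a + 1..<?a + 1 + (p - r)] = map (\<lambda>_. break (Suc e)) [?a + 1..<?a + 1 + (p - r)]"
    using assms(2) break_index_less_length[OF assms(1), of "Suc e"] b
    by (intro map_cong nth_knots_block[OF assms(1)]) auto
  also have "\<dots> = replicate (p - r) (break (Suc e))" by (simp add: map_replicate_const del: upt_Suc)
  finally show ?thesis unfolding split map_append mset_append
    by (simp del: upt_Suc)
qed

text \<open>The blossom is evaluated on the piece at the smallest argument; the multiplicities of the
  arguments make it agree with every piece \<open>m\<close> on which the target B-spline \<open>j\<close> lives.\<close>

lemma blossom_on_any_piece:
  assumes rp: "1 \<le> r" "r < p" and sq: "s < q"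
    and m: "m \<le> k" "j \<le> break_index p r m" "break_index p r m \<le> j + p"
    and xs: "length xs = q" "Min (set xs) = knots p r \<tau> ! h" "j + 1 \<le> h" "h \<le> j + 2"
    and i: "i < spline_dim q s \<tau>"
    and count: "\<And>e. e < k \<Longrightarrow> j \<le> break_index p r e \<Longrightarrow> break_index p r (Suc e) \<le> j + p \<Longrightarrow>
      q - s \<le> count (mset xs) (break (Suc e))"
  shows "bspline_blossom q s \<tau> i xs = piece_blossom ((!) (knots q s \<tau>)) (break_index q s m) xs i"
proof -
  let ?t = "(!) (knots p r \<tau>)"
  have h: "h < length (knots p r \<tau>)"
    using break_index_mono[OF m(1), of p r] m(2) xs(4) rp
    by (simp add: length_knots spline_dim_eq[OF rp(2)])
  then have "?t h \<in> break ` {..Suc k}" using set_knots[OF rp(2)] nth_mem by blast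
  then obtain e where e: "e \<le> Suc k" "?t h = break e" by auto
  let ?e = "min e k"
  \<comment> \<open>This and the next fact: B-spline \<open>j\<close> lives on the piece
    \<open>?e\<close> that the definition of the blossom selects.\<close>
  have le: "j \<le> break_index p r ?e"
  proof (cases "e \<le> k")
    case True
    have "\<not> break_index p r e < h"
    proof
      assume "break_index p r e < h"
      then have "?t (break_index p r e + 1) \<le> ?t h" using h by (intro knots_mono[OF rp(2)]) auto
      then show False
        using nth_knots_Suc_break[OF rp(2) True] break_less[of e "Suc e"] e True by simp
    qed
    then show ?thesis using True xs by simp
  next
    case False
    then show ?thesis using break_index_mono[OF m(1), of p r] m(2) by simp
  qed
  \<comment> \<open>The break before \<open>e\<close> has its last copy below \<open>h\<close>, thus
    at most at \<open>j + 1\<close>. Adding an inner block of \<open>p - r\<close> knots stays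
    within \<open>j + p\<close> because \<open>r \<ge> 1\<close>.\<close>
  have ge: "break_index p r ?e \<le> j + p"
  proof (cases e)
    case 0
    then show ?thesis by (simp add: break_index_def)
  next
    case (Suc e')
    have "\<not> h \<le> break_index p r e'"
    proof
      assume "h \<le> break_index p r e'"
      then have "?t h \<le> ?t (break_index p r e')"
        using break_index_less_length[OF rp(2), of e'] e Suc by (intro knots_mono[OF rp(2)]) auto
      then show False
        using nth_knots_break[OF rp(2), of e'] break_less[of e' e] e Suc by simp
    qed
    then have less: "break_index p r e' < h" by simp
    show ?thesis
    proof (cases "e \<le> k")
      case True
      then show ?thesis using Suc xs(4) rp less by (simp add: break_index_Suc)
    next
      case False
      then have "e' = k" "?e = k" using e Suc by auto
      then show ?thesis using xs(4) rp less by simp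
    qed
  qed
  have agree: "piece_blossom ((!) (knots q s \<tau>)) (break_index q s a) xs i =
      piece_blossom ((!) (knots q s \<tau>)) (break_index q s b) xs i"
    if "a \<le> b" "b \<le> k" "j \<le> break_index p r a" "break_index p r b \<le> j + p" for a b
  proof (rule piece_blossom_knots_cong[OF sq that(1,2) xs(1)])
    show "q - s \<le> count (mset xs) (break (Suc f))" if "a \<le> f" "f < b" for f
    proof (rule count)
      show "f < k" using that \<open>b \<le> k\<close> by simp
      show "j \<le> break_index p r f"
        using \<open>j \<le> break_index p r a\<close> break_index_mono[OF that(1), of p r] by simp
      show "break_index p r (Suc f) \<le> j + p"
        using \<open>break_index p r b \<le> j + p\<close> break_index_mono[of "Suc f" b p r] that by simp
    qed
  qed
  have "bspline_blossom q s \<tau> i xs = piece_blossom ((!) (knots q s \<tau>)) (break_index q s ?e) xs i"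
    using bspline_blossom_eq_piece_blossom[OF sq i xs(1)] xs(2) e by simp
  also have "\<dots> = piece_blossom ((!) (knots q s \<tau>)) (break_index q s m) xs i"
    using agree[of ?e m] agree[of m ?e] le ge m by (cases "?e \<le> m") auto
  finally show ?thesis .
qed

text \<open>Regularity \<open>s \<ge> r\<close> requires no more copies of a knot than the full
  block provides. The arguments are given up to order because \<open>A_tilde\<close> puts its
  distinguished knot last.\<close>

lemma blossom_at_consecutive_knots:
  assumes "1 \<le> r" "r \<le> s" "s < p"
    and m: "m \<le> k" "j \<le> break_index p r m" "break_index p r m \<le> j + p"
    and i: "i < spline_dim p s \<tau>"
    and xs: "mset xs = mset (map ((!) (knots p r \<tau>)) [j + 1..<j + 1 + p])"
  shows "bspline_blossom p s \<tau> i xs = piece_blossom ((!) (knots p s \<tau>)) (break_index p s m) xs i"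
proof (rule blossom_on_any_piece[where h = "j + 1", OF assms(1) _ assms(3) m])
  show rp: "r < p" using assms by simp
  show "length xs = p" using mset_eq_length[OF xs] by simp
  have "set xs = (!) (knots p r \<tau>) ` {j + 1..<j + 1 + p}"
    using arg_cong[OF xs, of set_mset] by (simp del: upt_Suc)
  moreover have "j + p < length (knots p r \<tau>)"
    using break_index_mono[OF m(1), of p r] m(2) by (simp add: length_knots spline_dim_eq[OF rp])
  ultimately show "Min (set xs) = knots p r \<tau> ! (j + 1)"
    using rp by (auto intro!: Min_eqI knots_mono[OF rp])
  show "p - s \<le> count (mset xs) (break (Suc e))"
    if "e < k" "j \<le> break_index p r e" "break_index p r (Suc e) \<le> j + p" for e
    using count_knot_block[OF rp that] assms unfolding xs by linarith
qed (use i in auto)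

text \<open>Deleting a knot costs at most one copy, and degree \<open>p - 1\<close> with the same
  regularity requires one copy less. Deleting the first knot moves the smallest argument to index
  \<open>j + 2\<close>.\<close>

lemma blossom_at_all_but_one_knot:
  assumes "1 \<le> r" "Suc r < p" "l < p"
    and m: "m \<le> k" "j \<le> break_index p r m" "break_index p r m \<le> j + p"
    and i: "i < spline_dim (p - 1) r \<tau>"
    and xs: "xs = delete_nth l (map ((!) (knots p r \<tau>)) [j + 1..<j + 1 + p])"
  shows "bspline_blossom (p - 1) r \<tau> i xs =
    piece_blossom ((!) (knots (p - 1) r \<tau>)) (break_index (p - 1) r m) xs i"
proof (rule blossom_on_any_piece[where h = "if l = 0 then j + 2 else j + 1", OF assms(1) _ _ m])
  let ?t = "(!) (knots p r \<tau>)"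
  let ?ys = "map ?t [j + 1..<j + 1 + p]"
  show rp: "r < p" "r < p - 1" using assms by auto
  show len: "length xs = p - 1" using assms(3) by (simp add: xs)
  have bound: "j + p < length (knots p r \<tau>)"
    using break_index_mono[OF m(1), of p r] m(2) by (simp add: length_knots spline_dim_eq[OF rp(1)])
  show "Min (set xs) = ?t (if l = 0 then j + 2 else j + 1)"
  proof (cases "l = 0")
    case True
    then have "set xs = ?t ` {j + 2..<j + 1 + p}" by (simp add: xs delete_nth_def drop_map del: upt_Suc)
    then show ?thesis
      using True rp bound by (auto intro!: Min_eqI knots_mono[OF rp(1)])
  next
    case False
    have "xs ! 0 = ?t (j + 1)"
      using False assms(3) by (simp add: xs delete_nth_def nth_append)
    then have "?t (j + 1) \<in> set xs" using len rp by (metis nth_mem not_less0 neq0_conv)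
    moreover have "set xs \<subseteq> ?t ` {j + 1..<j + 1 + p}"
      unfolding xs delete_nth_def using set_take_subset[of l ?ys] set_drop_subset[of "Suc l" ?ys] by auto
    ultimately show ?thesis
      using False bound by (auto intro!: Min_eqI knots_mono[OF rp(1)])
  qed
  show "p - 1 - r \<le> count (mset xs) (break (Suc e))"
    if "e < k" "j \<le> break_index p r e" "break_index p r (Suc e) \<le> j + p" for e
  proof -
    have "mset xs = mset ?ys - {#?ys ! l#}" unfolding xs by (rule mset_delete_nth) (use assms(3) in simp)
    then have "count (mset ?ys) (break (Suc e)) \<le> Suc (count (mset xs) (break (Suc e)))"
      by (auto simp del: upt_Suc mset_map)
    then show ?thesis using count_knot_block[OF rp(1) that] by linarith
  qed
qed (use i in auto)

section \<open>Knot insertion and multiplication by a linear factor\<close>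

lemma bspline_knot_insertion:
  assumes "1 \<le> r" "Suc r < p" "x \<in> {0..1}" "i < spline_dim p (Suc r) \<tau>"
  shows "bspline p (Suc r) \<tau> i x = (\<Sum>j<spline_dim p r \<tau>. A_bar p r \<tau> $$ (i, j) * bspline p r \<tau> j x)"
proof -
  obtain m where m: "m \<le> k" "break m \<le> x" "x \<le> break (Suc m)" using ex_piece assms(3) by blast
  have rp: "r < p" using assms by simp
  let ?G = "\<lambda>xs. piece_blossom ((!) (knots p (Suc r) \<tau>)) (break_index p (Suc r) m) xs i"
  have "bspline p (Suc r) \<tau> i x = ?G (replicate p x)"
    by (rule bspline_eq_piece_blossom[OF assms(2) m assms(4)])
  also have "\<dots> = (\<Sum>j<spline_dim p r \<tau>. A_bar p r \<tau> $$ (i, j) * bspline p r \<tau> j x)"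
  proof (rule spline_expansion[OF rp _ m])
    show "polar p ?G" using knot_interval_knots[OF assms(2) m(1)] by (rule polar_piece_blossom)
    fix j
    assume j: "j \<le> break_index p r m" "break_index p r m \<le> j + p"
    then have "j < spline_dim p r \<tau>"
      using break_index_mono[OF m(1), of p r] by (simp add: spline_dim_eq[OF rp])
    then have "A_bar p r \<tau> $$ (i, j) = bspline_blossom p (Suc r) \<tau> i (map ((!) (knots p r \<tau>)) [j + 1..<j + 1 + p])"
      using assms(4) by (simp add: A_bar_def Let_def add_ac)
    also have "\<dots> = ?G (map ((!) (knots p r \<tau>)) [j + 1..<j + 1 + p])"
      by (rule blossom_at_consecutive_knots[OF assms(1) _ assms(2) m(1) j assms(4)]) auto
    finally show "A_bar p r \<tau> $$ (i, j) = ?G (map ((!) (knots p r \<tau>)) [j + 1..<j + 1 + p])" .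
  qed
  finally show ?thesis .
qed

lemma bspline_times_linear:
  assumes "1 \<le> r" "Suc r < p" "x \<in> {0..1}" "i < spline_dim (p - 1) r \<tau>"
  shows "((1 - x) * w0 + x * w1) * bspline (p - 1) r \<tau> i x =
    (\<Sum>j<spline_dim p r \<tau>. A_hat p r \<tau> w0 w1 $$ (i, j) * bspline p r \<tau> j x)"
proof -
  obtain m where m: "m \<le> k" "break m \<le> x" "x \<le> break (Suc m)" using ex_piece assms(3) by blast
  have rp: "r < p" "r < p - 1" "p = Suc (p - 1)" using assms by auto
  define w where "w y = (1 - y) * w0 + y * w1" for y :: real
  let ?B = "\<lambda>xs. piece_blossom ((!) (knots (p - 1) r \<tau>)) (break_index (p - 1) r m) xs i"
  let ?t = "(!) (knots p r \<tau>)"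
  have "w x * bspline (p - 1) r \<tau> i x = w x * ?B (replicate (p - 1) x)"
    by (simp only: bspline_eq_piece_blossom[OF rp(2) m assms(4)])
  also have "\<dots> = lin_mult w ?B (replicate p x)"
    using lin_mult_diagonal[of w ?B "p - 1" x] rp(3) by simp
  also have "\<dots> = (\<Sum>j<spline_dim p r \<tau>. A_hat p r \<tau> w0 w1 $$ (i, j) * bspline p r \<tau> j x)"
  proof (rule spline_expansion[OF rp(1) _ m])
    have "polar (Suc (p - 1)) (lin_mult w ?B)"
      by (intro polar_lin_mult polar_piece_blossom knot_interval_knots[OF rp(2) m(1)])
        (simp add: w_def algebra_simps)
    then show "polar p (lin_mult w ?B)" using rp(3) by simp
    fix j
    assume j: "j \<le> break_index p r m" "break_index p r m \<le> j + p"
    \<comment> \<open>\<open>A_hat\<close> skips a knot by its absolute index,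
      \<open>lin_mult\<close> by its position among the \<open>p\<close> arguments; hence the shift
      by \<open>j + 1\<close>.\<close>
    have del: "map ?t ([j + 1..<j + 1 + l] @ [j + 1 + l + 1..<j + p + 1]) = delete_nth l (map ?t [j + 1..<j + 1 + p])"
      if "l < p" for l
      using that by (simp add: delete_nth_def take_map drop_map add_ac del: upt_Suc)
    have "j < spline_dim p r \<tau>"
      using j break_index_mono[OF m(1), of p r] by (simp add: spline_dim_eq[OF rp(1)])
    then have "A_hat p r \<tau> w0 w1 $$ (i, j) = 1 / real p * (\<Sum>l\<in>{j+1..j+p}. w (?t l) *
         bspline_blossom (p - 1) r \<tau> i (map ?t ([j+1..<l] @ [l+1..<j+p+1])))"
      using assms(4) by (simp add: A_hat_def w_def Let_def)
    also have "(\<Sum>l\<in>{j+1..j+p}. w (?t l) *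
         bspline_blossom (p - 1) r \<tau> i (map ?t ([j+1..<l] @ [l+1..<j+p+1]))) =
       (\<Sum>l<p. w (?t (j + 1 + l)) *
         bspline_blossom (p - 1) r \<tau> i (map ?t ([j+1..<j+1+l] @ [j+1+l+1..<j+p+1])))"
      by (rule sum.reindex_bij_witness[of _ "\<lambda>l. j + 1 + l" "\<lambda>l. l - (j + 1)"]) auto
    also have "\<dots> = (\<Sum>l<p. w (?t (j + 1 + l)) * ?B (delete_nth l (map ?t [j + 1..<j + 1 + p])))"
    proof (rule sum.cong)
      fix l
      assume "l \<in> {..<p}"
      then have l: "l < p" by simp
      show "w (?t (j + 1 + l)) *
          bspline_blossom (p - 1) r \<tau> i (map ?t ([j+1..<j+1+l] @ [j+1+l+1..<j+p+1])) =
        w (?t (j + 1 + l)) * ?B (delete_nth l (map ?t [j + 1..<j + 1 + p]))"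
        unfolding del[OF l]
        by (simp only: blossom_at_all_but_one_knot[OF assms(1,2) l m(1) j assms(4) refl])
    qed simp
    also have "1 / real p * \<dots> = lin_mult w ?B (map ?t [j + 1..<j + 1 + p])"
      by (simp add: lin_mult_def del: upt_Suc)
    finally show "A_hat p r \<tau> w0 w1 $$ (i, j) = lin_mult w ?B (map ?t [j + 1..<j + 1 + p])" .
  qed
  finally show ?thesis by (simp add: w_def)
qed

subsection \<open>Derivatives of B-splines\<close>

text \<open>The derivatives of all pieces that meet at \<open>x\<close> agree: their blossoms are
  taken at \<open>p - 1\<close> copies of \<open>x\<close>, enough for multiplicity
  \<open>p - s\<close> because \<open>s \<ge> 1\<close>. So the one-sided derivatives
  combine.\<close>

lemma D01_bspline:
  assumes "1 \<le> s" "s < p" "i < spline_dim p s \<tau>" "m \<le> k" "break m \<le> x" "x \<le> break (Suc m)"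
  defines "B \<equiv> \<lambda>m xs. piece_blossom ((!) (knots p s \<tau>)) (break_index p s m) xs i"
  shows "D01 (bspline p s \<tau> i) x =
    real p * (B m (1 # replicate (p - 1) x) - B m (0 # replicate (p - 1) x))"
proof -
  define D where "D m = real p * (B m (1 # replicate (p - 1) x) - B m (0 # replicate (p - 1) x))" for m
  have agree: "D a = D b" if "a \<le> b" "b \<le> k" "break b \<le> x" "x \<le> break (Suc a)" for a b
  proof -
    have "B a (z # replicate (p - 1) x) = B b (z # replicate (p - 1) x)" for z
      unfolding B_def
    proof (rule piece_blossom_knots_cong[OF assms(2) that(1,2)])
      fix e
      assume "a \<le> e" "e < b"
      then have "break (Suc e) = x"
        using break_le[of "Suc a" "Suc e"] break_le[of "Suc e" b] that by simp
      moreover have "p - s \<le> p - 1" using assms(1) by arith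
      ultimately show "p - s \<le> count (mset (z # replicate (p - 1) x)) (break (Suc e))"
        by auto
    qed (use assms in simp)
    then show ?thesis by (simp add: D_def)
  qed
  have piece: "(bspline p s \<tau> i has_real_derivative D m) (at x within {break e..break (Suc e)})"
    if "e \<le> k" for e
  proof (cases "x \<in> {break e..break (Suc e)}")
    case True
    have "polar (p + length []) (B e)"
      unfolding B_def using knot_interval_knots[OF assms(2) that] polar_piece_blossom by simp
    from polar_deriv[OF this, of x]
    have deriv: "((\<lambda>t. B e (replicate p t)) has_real_derivative D e) (at x within {break e..break (Suc e)})"
      unfolding D_def by (simp add: has_field_derivative_at_within)
    have eq: "D e = D m"
    proof (cases "e \<le> m")
      case True
      then show ?thesis using assms(4,5) \<open>x \<in> _\<close> by (intro agree) auto
    next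
      case False
      then show ?thesis using assms(6) that \<open>x \<in> _\<close> by (intro agree[symmetric]) auto
    qed
    have val: "bspline p s \<tau> i t = B e (replicate p t)" if "t \<in> {break e..break (Suc e)}" for t
      unfolding B_def using bspline_eq_piece_blossom[OF assms(2) \<open>e \<le> k\<close> _ _ assms(3)] that by simp
    show ?thesis
      using deriv unfolding has_field_derivative_def eq
      by (rule has_derivative_transform[OF True, rotated]) (rule val)
  next
    case False
    \<comment> \<open>A piece away from \<open>x\<close> puts no condition on the derivative, as the
      filter is trivial.\<close>
    then have "at x within {break e..break (Suc e)} = bot"
      by (intro not_in_closure_trivial_limitI) simp
    then show ?thesis by (simp add: has_field_derivative_iff)
  qed
  \<comment> \<open>The pieces are joined from left to right; a limit within a union follows from
    the limits within its two parts.\<close>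
  have "(bspline p s \<tau> i has_real_derivative D m) (at x within {0..break (Suc n)})" if "n \<le> k" for n
    using that
  proof (induction n)
    case 0
    then show ?case using piece[of 0] by simp
  next
    case (Suc n)
    have "{0..break (Suc (Suc n))} = {0..break (Suc n)} \<union> {break (Suc n)..break (Suc (Suc n))}"
      using break_le[of 0 "Suc n"] break_le[of "Suc n" "Suc (Suc n)"] Suc.prems by auto
    then show ?case
      using Suc piece[of "Suc n"]
      unfolding has_field_derivative_iff by (simp add: at_within_union filterlim_sup)
  qed
  from this[of k] have deriv: "(bspline p s \<tau> i has_vector_derivative D m) (at x within {0..1})"
    by (simp add: has_real_derivative_iff_has_vector_derivative)
  have x: "x \<in> {0..1}"
    using assms(4-6) break_le[of 0 m] break_le[of "Suc m" "Suc k"] by simp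
  show ?thesis
    unfolding D_def[symmetric]
    by (rule vector_derivative_within_closed_interval[of 0 1, OF _ x deriv]) simp
qed

text \<open>Both knot vectors repeat inner knots \<open>p - 1 - r\<close> times and differ by one
  copy of each end knot, so knot indices shift by one.\<close>

lemma knots_extend: "r < p \<Longrightarrow> knots p (Suc r) \<tau> = 0 # knots (p - 1) r \<tau> @ [1]"
  by (cases p) (simp_all add: knots_def replicate_append_same)

lemma D01_bspline_expansion:
  assumes "1 \<le> r" "Suc r < p" "x \<in> {0..1}" "i < spline_dim p (Suc r) \<tau>"
  shows "D01 (bspline p (Suc r) \<tau> i) x =
    (\<Sum>j<spline_dim (p - 1) r \<tau>. A_tilde p r \<tau> $$ (i, j) * bspline (p - 1) r \<tau> j x)"
proof -
  obtain m where m: "m \<le> k" "break m \<le> x" "x \<le> break (Suc m)" using ex_piece assms(3) by blast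
  have rp: "r < p - 1" "r < p" "p = Suc (p - 1)" using assms by auto
  let ?t = "(!) (knots p (Suc r) \<tau>)" and ?t' = "(!) (knots (p - 1) r \<tau>)"
  let ?B = "\<lambda>xs. piece_blossom ?t (break_index p (Suc r) m) xs i"
  \<comment> \<open>The blossom of the derivative: the degree times the increment of the blossom in
    one argument.\<close>
  let ?G = "\<lambda>xs. real p * (?B (1 # xs) - ?B (0 # xs))"
  have B: "polar (Suc (p - 1)) ?B"
    using polar_piece_blossom[OF knot_interval_knots[OF assms(2) m(1)]] rp(3) by simp
  have "D01 (bspline p (Suc r) \<tau> i) x = ?G (replicate (p - 1) x)"
    by (rule D01_bspline[OF _ assms(2,4) m]) simp
  also have "\<dots> = (\<Sum>j<spline_dim (p - 1) r \<tau>. A_tilde p r \<tau> $$ (i, j) * bspline (p - 1) r \<tau> j x)"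
  proof (rule spline_expansion[OF rp(1) _ m])
    show "polar (p - 1) ?G" by (intro polar_diff_scale polar_Cons B)
    fix j
    assume j: "j \<le> break_index (p - 1) r m" "break_index (p - 1) r m \<le> j + (p - 1)"
    have idx: "break_index p (Suc r) m = Suc (break_index (p - 1) r m)"
      using rp by (simp add: break_index_def)
    have jdim: "j < spline_dim (p - 1) r \<tau>"
      unfolding spline_dim_eq[OF rp(1)] using j break_index_mono[OF m(1), of "p - 1" r] by simp
    define zs where "zs = map ?t' [j + 1..<j + p]"
    have zs: "zs = map ?t [j + 2..<j + 1 + p]"
    proof (rule nth_equalityI)
      fix a
      assume "a < length zs"
      then have "a < p - 1" by (simp add: zs_def)
      then have "j + 1 + a < length (knots (p - 1) r \<tau>)"
        using jdim by (simp add: length_knots)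
      then show "zs ! a = map ?t [j + 2..<j + 1 + p] ! a"
        using \<open>a < p - 1\<close> by (simp add: zs_def knots_extend[OF rp(2)] nth_append del: upt_Suc)
    qed (simp add: zs_def del: upt_Suc)
    have len: "length zs = p - 1" by (simp add: zs_def)
    \<comment> \<open>The neighbours of \<open>zs\<close>: either one completes it to
      \<open>p\<close> consecutive knots of degree \<open>p\<close>, regularity
      \<open>r + 1\<close>.\<close>
    let ?x = "?t (j + 1)" and ?y = "?t (j + p + 1)"
    have less: "?x < ?y"
      by (rule knot_interval_less[OF knot_interval_knots[OF assms(2) m(1)]])
        (use j idx rp in auto)
    have "bspline_blossom p (Suc r) \<tau> i (zs @ [?x]) = ?B (zs @ [?x])"
    proof (rule blossom_at_consecutive_knots[OF _ _ assms(2) m(1) _ _ assms(4)])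
      have "?x # zs = map ?t [j + 1..<j + 1 + p]"
        unfolding zs using rp by (simp add: upt_conv_Cons del: upt_Suc)
      then show "mset (zs @ [?x]) = mset (map ?t [j + 1..<j + 1 + p])" by (metis mset.simps(2) mset_append add_mset_add_single mset_single_iff_right)
    qed (use j idx rp in auto)
    also have "\<dots> = ?B (?x # zs)" using len by (intro polar_perm[OF B]) auto
    finally have bx: "bspline_blossom p (Suc r) \<tau> i (zs @ [?x]) = ?B (?x # zs)" .
    have "bspline_blossom p (Suc r) \<tau> i (zs @ [?y]) = ?B (zs @ [?y])"
    proof (rule blossom_at_consecutive_knots[OF _ _ assms(2) m(1) _ _ assms(4)])
      have "zs @ [?y] = map ?t [j + 1 + 1..<j + 1 + 1 + p]"
        unfolding zs using rp by (simp add: upt_Suc_append)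
      then show "mset (zs @ [?y]) = mset (map ?t [j + 1 + 1..<j + 1 + 1 + p])" by metis
    qed (use j idx rp in auto)
    also have "\<dots> = ?B (?y # zs)" using len by (intro polar_perm[OF B]) auto
    finally have yB: "bspline_blossom p (Suc r) \<tau> i (zs @ [?y]) = ?B (?y # zs)" .
    have head: "?B (z # zs) = (1 - z) * ?B (0 # zs) + z * ?B (1 # zs)" for z
      using polar_head[OF B len, of z 0 1] by simp
    \<comment> \<open>By affinity the difference quotient between the two knots in
      \<open>A_tilde\<close> equals the increment from 0 to 1.\<close>
    have diff: "?B (?y # zs) - ?B (?x # zs) = (?y - ?x) * (?B (1 # zs) - ?B (0 # zs))"
      unfolding head[of ?x] head[of ?y] by (simp add: algebra_simps del: piece_blossom.simps)
    have "A_tilde p r \<tau> $$ (i, j) = real p / (?y - ?x) *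
        (bspline_blossom p (Suc r) \<tau> i (zs @ [?y]) - bspline_blossom p (Suc r) \<tau> i (zs @ [?x]))"
      using jdim assms(4) by (simp add: A_tilde_def Let_def zs_def)
    also have "\<dots> = ?G zs"
      unfolding bx yB diff using less by (simp del: piece_blossom.simps)
    finally show "A_tilde p r \<tau> $$ (i, j) = ?G (map ?t' [j + 1..<j + 1 + (p - 1)])"
      using rp by (simp add: zs_def)
  qed
  finally show ?thesis .
qed

end

subsection \<open>The matrix representation\<close>

text \<open>At \<open>u = 0\<close> every term carrying side-dependent data vanishes, so the two
  patches prescribe the same values on the interface.\<close>

lemma (in inner_knots) bspline_at_0:
  assumes "s < q" "0 < q"
  shows "bspline q s \<tau> 0 0 = 1" "bspline q s \<tau> 1 0 = 0"
proof -
  have KI: "knot_interval ((!) (knots q s \<tau>)) q q"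
    using knot_interval_knots[OF assms(1), of 0] by (simp add: break_index_def)
  have "bspline q s \<tau> i 0 = (if i = 0 then 1 else 0)" if "i < spline_dim q s \<tau>" for i
  proof -
    have "bspline q s \<tau> i 0 = piece_blossom ((!) (knots q s \<tau>)) q (replicate q 0) i"
      using bspline_eq_piece_blossom[OF assms(1), of 0 0 i] break_le[of 0 1] that
      by (simp add: break_index_def)
    also have "\<dots> = (if i + q = q then 1 else 0)"
      using nth_knots_first[OF assms(1)] by (intro piece_blossom_left_end KI) auto
    finally show ?thesis by simp
  qed
  then show "bspline q s \<tau> 0 0 = 1" "bspline q s \<tau> 1 0 = 0"
    using assms by (auto simp: spline_dim_def)
qed

text \<open>A point lying on both patches lies on the interface, where \<open>u = 0\<close> on either side, so
  patchwise definitions only have to be compared there.\<close>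

lemma patchwise_defined:
  assumes "two_patch_param p r \<tau> F \<Omega>"
    and interface: "\<And>v. v \<in> {0..1} \<Longrightarrow> f Left 0 v = f Right 0 v"
    and "u \<in> {0..1}" "v \<in> {0..1}"
  shows "(SOME \<phi>. \<forall>S. \<forall>u\<in>{0..1}. \<forall>v\<in>{0..1}. \<phi> (F S (u, v)) = f S u v) (F S (u, v)) = (f S u v :: real)"
proof -
  have bij: "bij_betw (F S) unit_square (\<Omega> S)" for S
    using assms(1) by (simp add: two_patch_param_def)
  have inj: "(u, v) = (u', v')"
    if "F S (u, v) = F S (u', v')" "{u, v, u', v'} \<subseteq> {0..1}" for S u v u' v'
    using inj_onD[OF bij_betw_imp_inj_on[OF bij] that(1)] that(2) by simp
  have common: "u = 0 \<and> u' = 0 \<and> v = v'"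
    if eq: "F Left (u, v) = F Right (u', v')" and dom: "{u, v, u', v'} \<subseteq> {0..1}" for u v u' v'
  proof -
    have "F Left (u, v) \<in> \<Omega> Left" using bij_betwE[OF bij[of Left]] dom by simp
    moreover have "F Left (u, v) \<in> \<Omega> Right" unfolding eq using bij_betwE[OF bij[of Right]] dom by simp
    ultimately obtain y where y: "y \<in> {0..1}" "F Left (u, v) = F Left (0, y)"
      using assms(1) unfolding two_patch_param_def by blast
    have "F Left (0, y) = F Right (0, y)" using assms(1) y(1) by (simp add: two_patch_param_def)
    then have "F Right (u', v') = F Right (0, y)" using y(2) eq by simp
    then show ?thesis using inj[OF y(2)] inj[of Right u' v' 0 y] y(1) dom by simp
  qed
  define \<phi> where "\<phi> x = (THE z. \<exists>S. \<exists>u\<in>{0..1}. \<exists>v\<in>{0..1}. x = F S (u, v) \<and> z = f S u v)" for x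
  have unique: "f S' u' v' = f S u v"
    if "F S (u, v) = F S' (u', v')" "{u, v, u', v'} \<subseteq> {0..1}" for S S' u v u' v'
  proof (cases "S = S'")
    case True
    then show ?thesis using inj that by blast
  next
    case False
    then consider "S = Left" "S' = Right" | "S = Right" "S' = Left"
      by (cases S; cases S') auto
    then show ?thesis
    proof cases
      case 1
      then show ?thesis using common[of u v u' v'] that interface[of v] by simp
    next
      case 2
      then show ?thesis using common[of u' v' u v] that interface[of v] by auto
    qed
  qed
  have "\<phi> (F S (u, v)) = f S u v" if "u \<in> {0..1}" "v \<in> {0..1}" for S u v
    unfolding \<phi>_def
  proof (rule the_equality)
    show "\<exists>S'. \<exists>u'\<in>{0..1}. \<exists>v'\<in>{0..1}. F S (u, v) = F S' (u', v') \<and> f S u v = f S' u' v'"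
      using that by blast
    fix z
    assume "\<exists>S'. \<exists>u'\<in>{0..1}. \<exists>v'\<in>{0..1}. F S (u, v) = F S' (u', v') \<and> z = f S' u' v'"
    then obtain S' u' v' where *: "u' \<in> {0..1}" "v' \<in> {0..1}" "F S (u, v) = F S' (u', v')" "z = f S' u' v'"
      by blast
    show "z = f S u v" unfolding *(4) by (rule unique[OF *(3)]) (use that * in simp)
  qed
  then have "\<exists>\<phi>. \<forall>S. \<forall>u\<in>{0..1}. \<forall>v\<in>{0..1}. \<phi> (F S (u, v)) = f S u v" by blast
  from someI_ex[OF this] show ?thesis using assms(3,4) by blast
qed

text \<open>The zero pair yields the same \<open>beta_of\<close> with norm 0, so by minimality both
  squared norms are 0, and a continuous square with integral 0 vanishes.\<close>

lemma minimal_beta_eq_0: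
  assumes "minimal_beta \<alpha> \<beta>'" "beta_of \<alpha> \<beta>' = 0"
  shows "v \<in> {0..1} \<Longrightarrow> poly (\<beta>' S) v = 0"
proof -
  have zero: "poly q v = 0" if "integral {0..1} (\<lambda>v. (poly q v)\<^sup>2) = 0" "v \<in> {0..1}" for q :: "real poly" and v
  proof -
    have cont: "continuous_on {0..1} (\<lambda>v. (poly q v)\<^sup>2)" by (intro continuous_intros)
    then have "((\<lambda>v. (poly q v)\<^sup>2) has_integral 0) (cbox 0 1)"
      using integrable_integral[OF integrable_continuous_interval] that(1) by fastforce
    then have "(poly q v)\<^sup>2 = 0"
      by (rule has_integral_0_cbox_imp_0[rotated 2]) (use that cont in auto)
    then show ?thesis by simp
  qed
  have "sq_L2_norms \<beta>' \<le> sq_L2_norms (\<lambda>_. 0)"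
    using assms by (simp add: minimal_beta_def beta_of_def)
  then have "sq_L2_norms \<beta>' \<le> 0" by (simp add: sq_L2_norms_def)
  moreover have "0 \<le> integral {0..1} (\<lambda>v. (poly (\<beta>' S) v)\<^sup>2)" for S
    by (rule integral_nonneg) (intro integrable_continuous_interval continuous_intros, simp)
  from this[of Left] this[of Right] calculation have "integral {0..1} (\<lambda>v. (poly (\<beta>' S) v)\<^sup>2) = 0"
    unfolding sq_L2_norms_def by (cases S; hypsubst; linarith)
  then show "v \<in> {0..1} \<Longrightarrow> poly (\<beta>' S) v = 0" by (rule zero)
qed

section \<open>Linear polynomials and block matrices\<close>

lemma poly_linear_interpolation:
  fixes q :: "real poly"
  assumes "degree q \<le> 1"
  shows "poly q v = (1 - v) * poly q 0 + v * poly q 1"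
proof -
  have "q = [:coeff q 0, coeff q 1:]"
    using assms by (intro poly_eqI) (auto simp: coeff_pCons coeff_eq_0 split: nat.splits)
  from arg_cong[OF this, of poly] have "poly q x = coeff q 0 + x * coeff q 1" for x by simp
  then show ?thesis by (simp add: algebra_simps)
qed

lemma mult_four_block_upper_vec:
  assumes "A \<in> carrier_mat l n" "B \<in> carrier_mat l n" "D \<in> carrier_mat m n"
    and "\<And>i. i < l \<Longrightarrow> f i = (\<Sum>j<n. A $$ (i, j) * x j) + (\<Sum>j<n. B $$ (i, j) * y j)"
    and "\<And>i. i < m \<Longrightarrow> g i = (\<Sum>j<n. D $$ (i, j) * y j)"
  shows "Matrix.vec l f @\<^sub>v Matrix.vec m g =
    four_block_mat A B (0\<^sub>m m n) D *\<^sub>v (Matrix.vec n x @\<^sub>v Matrix.vec n (y :: nat \<Rightarrow> real))"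
proof -
  have entry: "vec_index (M *\<^sub>v Matrix.vec n z) i = (\<Sum>j<n. M $$ (i, j) * z j)"
    if "M \<in> carrier_mat d n" "i < d" for M :: "real mat" and d i and z :: "nat \<Rightarrow> real"
    using that by (simp add: scalar_prod_def row_def atLeast0LessThan)
  have "four_block_mat A B (0\<^sub>m m n) D *\<^sub>v (Matrix.vec n x @\<^sub>v Matrix.vec n y) =
      (A *\<^sub>v Matrix.vec n x + B *\<^sub>v Matrix.vec n y) @\<^sub>v (0\<^sub>m m n *\<^sub>v Matrix.vec n x + D *\<^sub>v Matrix.vec n y)"
    by (rule four_block_mat_mult_vec) (use assms in auto)
  also have "A *\<^sub>v Matrix.vec n x + B *\<^sub>v Matrix.vec n y = Matrix.vec l f"
    using assms by (intro eq_vecI) (auto simp: entry[OF assms(1)] entry[OF assms(2)] simp del: index_mult_mat_vec)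
  also have "0\<^sub>m m n *\<^sub>v Matrix.vec n x + D *\<^sub>v Matrix.vec n y = Matrix.vec m g"
    using assms by (intro eq_vecI) (auto simp: entry[OF assms(3)] entry[of "0\<^sub>m m n" m] simp del: index_mult_mat_vec)
  finally show ?thesis by simp
qed

lemma sum_one_mat:
  "i < n \<Longrightarrow> (\<Sum>j<n. (1\<^sub>m n :: real mat) $$ (i, j) * f j) = f i"
proof -
  assume "i < n"
  then have "(\<Sum>j<n. (1\<^sub>m n :: real mat) $$ (i, j) * f j) = (\<Sum>j<n. if j = i then f j else 0)"
    by (intro sum.cong) auto
  then show ?thesis using \<open>i < n\<close> by simp
qed

text \<open>A matrix product composes two expansions, here differentiation and then multiplication
  by a linear factor.\<close>

lemma sum_mult_mat:
  assumes "A \<in> carrier_mat l m" "B \<in> carrier_mat m n" "i < l"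
  shows "(\<Sum>j<n. (A * B) $$ (i, j) * f j) = (\<Sum>a<m. A $$ (i, a) * (\<Sum>j<n. B $$ (a, j) * (f j :: real)))"
proof -
  have "(A * B) $$ (i, j) = (\<Sum>a<m. A $$ (i, a) * B $$ (a, j))" if "j < n" for j
    using assms that by (simp add: scalar_prod_def row_def col_def atLeast0LessThan)
  then have "(\<Sum>j<n. (A * B) $$ (i, j) * f j) = (\<Sum>j<n. \<Sum>a<m. A $$ (i, a) * (B $$ (a, j) * f j))"
    by (simp add: sum_distrib_right mult.assoc)
  also have "\<dots> = (\<Sum>a<m. A $$ (i, a) * (\<Sum>j<n. B $$ (a, j) * f j))"
    by (subst sum.swap) (simp add: sum_distrib_left)
  finally show ?thesis .
qed

theorem lemma16:
  fixes p r k :: nat and \<tau> :: "real list"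
    and F :: "side \<Rightarrow> real \<times> real \<Rightarrow> real \<times> real" and \<Omega> :: "side \<Rightarrow> (real \<times> real) set"
    and \<alpha> \<beta>' :: "side \<Rightarrow> real poly" and \<beta> :: "real poly" and n n_tilde n_bar :: nat
  assumes "3 \<le> p" and "1 \<le> r" and "r \<le> p - 2"
    and "length \<tau> = k" and "sorted_wrt (<) \<tau>" and "set \<tau> \<subseteq> {0<..<1}"
    and "two_patch_param p r \<tau> F \<Omega>"
    and "gluing_data F \<alpha> \<beta>'" and "minimal_beta \<alpha> \<beta>'"
    and "\<beta> = beta_of \<alpha> \<beta>'"
    and "\<beta> = 0 \<or> z_beta \<tau> \<beta> = 0"
    and "n = p + 1 + k * (p - r)"
    and "n_tilde = spline_dim p (tilde_reg r \<beta>) \<tau>"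
    and "n_bar = spline_dim (p - d_alpha \<alpha>) r \<tau>"
  shows "\<exists>A1 A2 A3.
    (\<forall>S. A1 \<in> carrier_mat n_tilde n \<and> A2 S \<in> carrier_mat n_tilde n \<and> A3 S \<in> carrier_mat n_bar n
      \<and> (\<beta> = 0 \<longrightarrow> A1 = 1\<^sub>m n \<and> A2 S = 1\<^sub>m n)
      \<and> (\<beta> \<noteq> 0 \<and> z_beta \<tau> \<beta> = 0 \<longrightarrow>
            A1 = A_bar p r \<tau>
            \<and> A2 S = A_bar p r \<tau> + (1 / (real (k + 1) * real p)) \<cdot>\<^sub>m
                 (A_tilde p r \<tau> * A_hat p r \<tau> (poly (\<beta>' S) 0) (poly (\<beta>' S) 1)))
      \<and> (d_alpha \<alpha> = 0 \<longrightarrow> A3 S = (1 / (real (k + 1) * real p) * poly (\<alpha> S) 0) \<cdot>\<^sub>m 1\<^sub>m n)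
      \<and> (d_alpha \<alpha> = 1 \<longrightarrow> A3 S = (1 / (real (k + 1) * real p)) \<cdot>\<^sub>m
            A_hat p r \<tau> (poly (\<alpha> S) 0) (poly (\<alpha> S) 1))
      \<and> (\<forall>u\<in>{0..1}. \<forall>v\<in>{0..1}.
            Matrix.vec n_tilde (\<lambda>i. phi0 p r \<tau> F \<alpha> \<beta>' i (F S (u, v)))
              @\<^sub>v Matrix.vec n_bar (\<lambda>j. phi1 p r \<tau> F \<alpha> j (F S (u, v)))
            = four_block_mat A1 (A2 S) (0\<^sub>m n_bar n) (A3 S) *\<^sub>v
                (Matrix.vec n (\<lambda>j. bspline p r \<tau> 0 u * bspline p r \<tau> j v)
                  @\<^sub>v Matrix.vec n (\<lambda>j. bspline p r \<tau> 1 u * bspline p r \<tau> j v))))"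
proof -
  interpret inner_knots \<tau> using assms(5,6) by unfold_locales
  have rp: "r < p" "Suc r < p" "r < p - 1" using assms(1-3) by auto
  note dim = assms(12)[folded assms(4)]
  have n: "n = spline_dim p r \<tau>" using dim by (simp add: spline_dim_def)
  let ?c = "1 / (real (k + 1) * real p)"
  let ?N = "bspline p r \<tau>"
  let ?g = "bspline p (tilde_reg r \<beta>) \<tau>"
  define A1 where "A1 = (if \<beta> = 0 then 1\<^sub>m n else A_bar p r \<tau>)"
  define A2 where "A2 S = (if \<beta> = 0 then 1\<^sub>m n else A_bar p r \<tau> + ?c \<cdot>\<^sub>m
    (A_tilde p r \<tau> * A_hat p r \<tau> (poly (\<beta>' S) 0) (poly (\<beta>' S) 1)))" for S
  define A3 where "A3 S = (if d_alpha \<alpha> = 0 then (?c * poly (\<alpha> S) 0) \<cdot>\<^sub>m 1\<^sub>m n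
    else ?c \<cdot>\<^sub>m A_hat p r \<tau> (poly (\<alpha> S) 0) (poly (\<alpha> S) 1))" for S
  have deg: "degree (\<alpha> S) \<le> 1" "degree (\<beta>' S) \<le> 1" for S
    using assms(8) by (auto simp: gluing_data_def)
  have d: "d_alpha \<alpha> = 0 \<or> d_alpha \<alpha> = 1" 
    using deg(1)[of Left] deg(1)[of Right] unfolding d_alpha_def by arith
  have hat: "A_hat p r \<tau> w0 w1 \<in> carrier_mat (spline_dim (p - 1) r \<tau>) n" for w0 w1
    by (simp add: A_hat_def n Let_def)
  have bar: "A_bar p r \<tau> \<in> carrier_mat (spline_dim p (Suc r) \<tau>) n"
    by (simp add: A_bar_def n Let_def)
  have tilde: "A_tilde p r \<tau> \<in> carrier_mat (spline_dim p (Suc r) \<tau>) (spline_dim (p - 1) r \<tau>)"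
    by (simp add: A_tilde_def Let_def)
  have nt: "n_tilde = (if \<beta> = 0 then n else spline_dim p (Suc r) \<tau>)"
    by (simp add: assms(13) tilde_reg_def n)
  have nb: "n_bar = (if d_alpha \<alpha> = 0 then n else spline_dim (p - 1) r \<tau>)"
    using d by (auto simp: assms(14) n)
  have A1: "A1 \<in> carrier_mat n_tilde n" using bar by (simp add: A1_def nt)
  have A2: "A2 S \<in> carrier_mat n_tilde n" for S
    using bar tilde hat by (simp add: A2_def nt)
  have A3: "A3 S \<in> carrier_mat n_bar n" for S
    using hat by (simp add: A3_def nb)
  have N0: "?N 0 0 = 1" "?N 1 0 = 0" using bspline_at_0[OF rp(1)] assms(1) by auto
  have phi0: "phi0 p r \<tau> F \<alpha> \<beta>' i (F S (u, v)) =
      ?g i v * (?N 0 u + ?N 1 u) + poly (\<beta>' S) v * D01 (?g i) v * ?c * ?N 1 u"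
    if "u \<in> {0..1}" "v \<in> {0..1}" for i S u v
    unfolding phi0_def Let_def assms(10)[symmetric] assms(4)
    by (rule patchwise_defined[OF assms(7) _ that, where f = "\<lambda>S u v. ?g i v * (?N 0 u + ?N 1 u) +
      poly (\<beta>' S) v * D01 (?g i) v * ?c * ?N 1 u"]) (simp add: N0[simplified])
  have phi1: "phi1 p r \<tau> F \<alpha> j (F S (u, v)) =
      ?c * poly (\<alpha> S) v * bspline (p - d_alpha \<alpha>) r \<tau> j v * ?N 1 u"
    if "u \<in> {0..1}" "v \<in> {0..1}" for j S u v
    unfolding phi1_def assms(4)
    by (rule patchwise_defined[OF assms(7) _ that, where f = "\<lambda>S u v. ?c * poly (\<alpha> S) v *
      bspline (p - d_alpha \<alpha>) r \<tau> j v * ?N 1 u"]) (simp add: N0[simplified])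
  have linear: "poly w v * bspline (p - 1) r \<tau> i v =
      (\<Sum>j<n. A_hat p r \<tau> (poly w 0) (poly w 1) $$ (i, j) * ?N j v)"
    if "v \<in> {0..1}" "i < spline_dim (p - 1) r \<tau>" "degree w \<le> 1" for v i and w :: "real poly"
    using bspline_times_linear[OF assms(2) rp(2) that(1,2), of "poly w 0" "poly w 1"]
    by (simp flip: n poly_linear_interpolation[OF that(3)])
  have scale: "(\<Sum>j<n. M j * (z * ?N j v)) = z * (\<Sum>j<n. M j * ?N j v)" for M z v
    by (simp add: sum_distrib_left mult.left_commute)
  \<comment> \<open>Sorted by the factors in \<open>u\<close>, the first family has coefficient
    \<open>?g i v\<close> at \<open>?N 0 u\<close>, and the same plus the scaled gluing term at
    \<open>?N 1 u\<close>. These functions of \<open>v\<close> are expanded here and in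
    \<open>row1\<close>.\<close>
  have row0: "?g i v = (\<Sum>j<n. A1 $$ (i, j) * ?N j v)" if "i < n_tilde" "v \<in> {0..1}" for i v
  proof (cases "\<beta> = 0")
    case True
    then show ?thesis using that by (simp add: A1_def tilde_reg_def nt sum_one_mat del: index_one_mat)
  next
    case False
    then show ?thesis
      using bspline_knot_insertion[OF assms(2) rp(2) that(2), of i] that(1)
      by (simp add: A1_def tilde_reg_def nt flip: n)
  qed
  have row1: "?g i v + poly (\<beta>' S) v * D01 (?g i) v * ?c = (\<Sum>j<n. A2 S $$ (i, j) * ?N j v)"
    if "i < n_tilde" and v: "v \<in> {0..1}" for i S v
  proof (cases "\<beta> = 0")
    case True
    \<comment> \<open>With \<beta> = 0 both gluing functions vanish on \<open>[0,1]\<close>, which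
      removes the derivative term.\<close>
    then show ?thesis
      using that minimal_beta_eq_0[OF assms(9) _ v, of S] assms(10)
      by (simp add: A2_def tilde_reg_def nt sum_one_mat del: index_one_mat)
  next
    case False
    then have i: "i < spline_dim p (Suc r) \<tau>" using that by (simp add: nt)
    let ?h = "A_hat p r \<tau> (poly (\<beta>' S) 0) (poly (\<beta>' S) 1)"
    \<comment> \<open>The derivative is expanded first; the linear factor then acts on each B-spline
      of degree \<open>p - 1\<close>.\<close>
    have "poly (\<beta>' S) v * D01 (?g i) v = (\<Sum>a<spline_dim (p - 1) r \<tau>. A_tilde p r \<tau> $$ (i, a) *
        (poly (\<beta>' S) v * bspline (p - 1) r \<tau> a v))"
      using False D01_bspline_expansion[OF assms(2) rp(2) v i]
      by (simp add: tilde_reg_def sum_distrib_left mult.left_commute)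
    also have "\<dots> = (\<Sum>a<spline_dim (p - 1) r \<tau>. A_tilde p r \<tau> $$ (i, a) * (\<Sum>j<n. ?h $$ (a, j) * ?N j v))"
      using linear[OF v _ deg(2)] by (intro sum.cong) auto
    also have "\<dots> = (\<Sum>j<n. (A_tilde p r \<tau> * ?h) $$ (i, j) * ?N j v)"
      by (rule sum_mult_mat[OF tilde hat i, symmetric])
    finally have "?g i v + poly (\<beta>' S) v * D01 (?g i) v * ?c =
        (\<Sum>j<n. A_bar p r \<tau> $$ (i, j) * ?N j v) + ?c * (\<Sum>j<n. (A_tilde p r \<tau> * ?h) $$ (i, j) * ?N j v)"
      using row0[OF that] False by (simp add: A1_def mult.commute)
    also have "\<dots> = (\<Sum>j<n. A2 S $$ (i, j) * ?N j v)"
      unfolding sum_distrib_left sum.distrib[symmetric]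
    proof (rule sum.cong)
      fix j
      assume "j \<in> {..<n}"
      then have "A2 S $$ (i, j) = A_bar p r \<tau> $$ (i, j) + ?c * (A_tilde p r \<tau> * ?h) $$ (i, j)"
        using False i tilde hat[of "poly (\<beta>' S) 0" "poly (\<beta>' S) 1"] bar by (simp add: A2_def del: index_mult_mat(1))
      then show "A_bar p r \<tau> $$ (i, j) * ?N j v + ?c * ((A_tilde p r \<tau> * ?h) $$ (i, j) * ?N j v) =
          A2 S $$ (i, j) * ?N j v"
        by (simp only: distrib_right mult.assoc)
    qed simp
    finally show ?thesis .
  qed
  have row2: "?c * poly (\<alpha> S) v * bspline (p - d_alpha \<alpha>) r \<tau> i v = (\<Sum>j<n. A3 S $$ (i, j) * ?N j v)"
    if "i < n_bar" and v: "v \<in> {0..1}" for i S v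
  proof (cases "d_alpha \<alpha> = 0")
    case True
    then have "degree (\<alpha> S) = 0" by (cases S) (simp_all add: d_alpha_def)
    then have const: "poly (\<alpha> S) v = poly (\<alpha> S) 0" by (elim degree_eq_zeroE) simp
    have "(\<Sum>j<n. A3 S $$ (i, j) * ?N j v) = (\<Sum>j<n. ?c * poly (\<alpha> S) 0 * ((1\<^sub>m n :: real mat) $$ (i, j) * ?N j v))"
      using that True by (intro sum.cong) (auto simp: A3_def nb)
    also have "\<dots> = ?c * poly (\<alpha> S) 0 * ?N i v"
      unfolding sum_distrib_left[symmetric]
      using that True by (simp add: nb sum_one_mat del: index_one_mat)
    finally show ?thesis using True const by simp
  next
    case False
    then have i: "i < spline_dim (p - 1) r \<tau>" using that by (simp add: nb)
    have "(\<Sum>j<n. A3 S $$ (i, j) * ?N j v) =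
        (\<Sum>j<n. ?c * (A_hat p r \<tau> (poly (\<alpha> S) 0) (poly (\<alpha> S) 1) $$ (i, j) * ?N j v))"
      using False i hat[of "poly (\<alpha> S) 0" "poly (\<alpha> S) 1"] by (intro sum.cong) (auto simp: A3_def)
    also have "\<dots> = ?c * (poly (\<alpha> S) v * bspline (p - 1) r \<tau> i v)"
      by (simp only: linear[OF v i deg(1)] sum_distrib_left)
    finally show ?thesis using False d by simp
  qed
  have repr: "Matrix.vec n_tilde (\<lambda>i. phi0 p r \<tau> F \<alpha> \<beta>' i (F S (u, v)))
        @\<^sub>v Matrix.vec n_bar (\<lambda>j. phi1 p r \<tau> F \<alpha> j (F S (u, v)))
      = four_block_mat A1 (A2 S) (0\<^sub>m n_bar n) (A3 S) *\<^sub>v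
          (Matrix.vec n (\<lambda>j. ?N 0 u * ?N j v) @\<^sub>v Matrix.vec n (\<lambda>j. ?N 1 u * ?N j v))"
    if uv: "u \<in> {0..1}" "v \<in> {0..1}" for S u v
  proof (rule mult_four_block_upper_vec[OF A1 A2 A3])
    fix i
    assume i: "i < n_tilde"
    show "phi0 p r \<tau> F \<alpha> \<beta>' i (F S (u, v)) = (\<Sum>j<n. A1 $$ (i, j) * (?N 0 u * ?N j v)) +
        (\<Sum>j<n. A2 S $$ (i, j) * (?N 1 u * ?N j v))"
      unfolding phi0[OF uv] scale row0[OF i uv(2), symmetric] row1[OF i uv(2), symmetric]
      by (simp only: distrib_left distrib_right ac_simps)
  next
    fix i
    assume i: "i < n_bar"
    show "phi1 p r \<tau> F \<alpha> i (F S (u, v)) = (\<Sum>j<n. A3 S $$ (i, j) * (?N 1 u * ?N j v))"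
      unfolding phi1[OF uv] scale row2[OF i uv(2), symmetric]
      by (simp only: ac_simps)
  qed
  show ?thesis
    using A1 A2 A3 repr
    by (intro exI[of _ A1] exI[of _ A2] exI[of _ A3]) (auto simp: A1_def A2_def A3_def assms(4))
qed

end
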